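(* For every configuration $C=p_r\dots p_s$ of g-2PATH, \[\mathrm{mft}_{\text{g-2PATH}}(C)\le \tilde T:=\min_{r\le i\le 0\le j\le s}\max\{-2i+j+g(i,j),\ 2j-i+f(i,j)\}.\]
   Context: Positions are elements of $\mathbb{Z}^2$; with $\epsilon_0=(1,0),\epsilon_1=(0,1),\epsilon_2=(-1,0),\epsilon_3=(0,-1)$, positions $p,p'$ are adjacent if $p'-p$ is some $\epsilon_i$. A configuration of g-2PATH is a sequence $C=p_rp_{r+1}\dots p_s$ ($r\le0\le s$) of positions with $p_0=(0,0)$ (the general), consecutive positions adjacent, all positions distinct, and $p_l,p_m$ not adjacent whenever $|l-m|\ge2$; it is identified with its set of positions. For $p\in C$, $\mathrm{bc}_C(p)=(b_0,\dots,b_3)\in\{0,1\}^4$ with $b_i=1$ iff $p+\epsilon_i\in C$. Firing squad model (boundary-sensitive): a finite automaton $A$ has a finite state set containing a quiescent state $\mathrm{Q}$, general states $\mathrm{G}_0,\dots,\mathrm{G}_{m-1}$, a set $\mathcal F$ of firing states with $\mathrm{Q}\notin\mathcal F$, a map $\tau:\{0,1\}^4\to\{0,\dots,m-1\}$, and a transition function giving the next state from the current state and the states of the four neighbours $p+\epsilon_i$ (the symbol $\#$ if there is no node there), with the requirement that a node in state $\mathrm{Q}$ whose four inputs all lie in $\{\mathrm{Q},\#\}$ stays in $\mathrm{Q}$. Placing a copy of $A$ at every position of a configuration $C$, at time $0$ the node $(0,0)$ is in state $\mathrm{G}_{\tau(\mathrm{bc}_C((0,0)))}$ and all other nodes are in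 $\mathrm{Q}$; all nodes update synchronously. $A$ is a solution of g-2PATH if for every configuration $C$ of g-2PATH there is a time $t_C$ such that no node is in $\mathcal F$ at any time $t<t_C$ and every node is in $\mathcal F$ at time $t_C$; then $\mathrm{ft}(C,A)=t_C$. Solutions exist, and $\mathrm{mft}_{\text{g-2PATH}}(C)=\min_A\mathrm{ft}(C,A)$ over all solutions $A$. For a fixed configuration $C=p_r\dots p_s$ and $r\le i\le0\le j\le s$: $W(i,j)$ is the set of pairs $(x_0,x_1)$ of finite, possibly empty, sequences of positions such that $x_0p_i\dots p_jx_1$ is a configuration $C'$ of g-2PATH (with general at $p_0$) satisfying $\mathrm{bc}_{C'}(p_l)=\mathrm{bc}_C(p_l)$ for all $i\le l\le j$. $U(i,j)=\{x_0:\exists x_1,(x_0,x_1)\in W(i,j)\}$, $V(i,j)=\{x_1:\exists x_0,(x_0,x_1)\in W(i,j)\}$, $f(i,j)=\sup\{|x_0|:x_0\in U(i,j)\}$, $g(i,j)=\sup\{|x_1|:x_1\in V(i,j)\}$, where $|x|$ is the number of positions in $x$; these may be $\infty$, with the convention $\max\{a,\infty\}=\infty$. *)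

theory Defs
  imports Main "HOL-Library.Extended_Nat"
begin

type_synonym pos = "int \<times> int"

definition eps :: "nat \<Rightarrow> pos" where
  "eps i = [(1,0),(0,1),(-1,0),(0,-1)] ! i"

definition padd :: "pos \<Rightarrow> pos \<Rightarrow> pos" where
  "padd p e = (fst p + fst e, snd p + snd e)"

definition adj :: "pos \<Rightarrow> pos \<Rightarrow> bool" where
  "adj p q \<longleftrightarrow> (\<exists>i<4. q = padd p (eps i))"

text \<open>A configuration of g-2PATH, given as the list [p_r, ..., p_s]; the general
  (0,0) must occur in it (its index is then -r).\<close>
definition is_config :: "pos list \<Rightarrow> bool" where
  "is_config L \<longleftrightarrow>
     (0,0) \<in> set L \<and> distinct L \<and>
     (\<forall>n. Suc n < length L \<longrightarrow> adj (L ! n) (L ! Suc n)) \<and>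
     (\<forall>l m. m < length L \<longrightarrow> l + 2 \<le> m \<longrightarrow> \<not> adj (L ! l) (L ! m))"

definition bc :: "pos set \<Rightarrow> pos \<Rightarrow> bool list" where
  "bc S p = map (\<lambda>i. padd p (eps i) \<in> S) [0..<4]"

text \<open>Finite automata for the boundary-sensitive firing squad model. States are
  encoded as natural numbers; the state set St is finite. The neighbour inputs are a
  list of length 4 (index i = neighbour p + epsilon_i), None standing for #.\<close>
record fsa =
  St    :: "nat set"
  Qst   :: nat
  Gst   :: "nat list"
  Fst   :: "nat set"
  tau   :: "bool list \<Rightarrow> nat"
  delta :: "nat \<Rightarrow> nat option list \<Rightarrow> nat"

definition wf_fsa :: "fsa \<Rightarrow> bool" where
  "wf_fsa A \<longleftrightarrow>
     finite (St A) \<and> Qst A \<in> St A \<and> Gst A \<noteq> [] \<and> set (Gst A) \<subseteq> St A \<and>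
     Fst A \<subseteq> St A \<and> Qst A \<notin> Fst A \<and>
     (\<forall>b. length b = 4 \<longrightarrow> tau A b < length (Gst A)) \<and>
     (\<forall>s ns. s \<in> St A \<longrightarrow> length ns = 4 \<longrightarrow> set ns \<subseteq> insert None (Some ` St A)
            \<longrightarrow> delta A s ns \<in> St A) \<and>
     (\<forall>ns. length ns = 4 \<longrightarrow> set ns \<subseteq> {None, Some (Qst A)} \<longrightarrow> delta A (Qst A) ns = Qst A)"

primrec run :: "fsa \<Rightarrow> pos set \<Rightarrow> nat \<Rightarrow> pos \<Rightarrow> nat" where
  "run A S 0 = (\<lambda>p. if p = (0,0) then Gst A ! tau A (bc S (0,0)) else Qst A)"
| "run A S (Suc t) = (\<lambda>p. delta A (run A S t p)
      (map (\<lambda>i. if padd p (eps i) \<in> S then Some (run A S t (padd p (eps i))) else None) [0..<4]))"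

definition fires_at :: "fsa \<Rightarrow> pos list \<Rightarrow> nat \<Rightarrow> bool" where
  "fires_at A L t \<longleftrightarrow>
     (\<forall>t'<t. \<forall>p\<in>set L. run A (set L) t' p \<notin> Fst A) \<and>
     (\<forall>p\<in>set L. run A (set L) t p \<in> Fst A)"

definition is_solution :: "fsa \<Rightarrow> bool" where
  "is_solution A \<longleftrightarrow> wf_fsa A \<and> (\<forall>L. is_config L \<longrightarrow> (\<exists>t. fires_at A L t))"

definition mft :: "pos list \<Rightarrow> enat" where
  "mft L = Inf {enat t | t A. is_solution A \<and> fires_at A L t}"

text \<open>p_l for the configuration L whose general sits at list index k.\<close>
definition cpos :: "pos list \<Rightarrow> nat \<Rightarrow> int \<Rightarrow> pos" where
  "cpos L k l = L ! nat (l + int k)"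

definition seg :: "pos list \<Rightarrow> nat \<Rightarrow> int \<Rightarrow> int \<Rightarrow> pos list" where
  "seg L k i j = map (cpos L k) [i..j]"

definition W :: "pos list \<Rightarrow> nat \<Rightarrow> int \<Rightarrow> int \<Rightarrow> (pos list \<times> pos list) set" where
  "W L k i j = {(x0, x1). is_config (x0 @ seg L k i j @ x1) \<and>
      (\<forall>l\<in>{i..j}. bc (set (x0 @ seg L k i j @ x1)) (cpos L k l) = bc (set L) (cpos L k l))}"

definition U :: "pos list \<Rightarrow> nat \<Rightarrow> int \<Rightarrow> int \<Rightarrow> pos list set" where
  "U L k i j = fst ` W L k i j"

definition V :: "pos list \<Rightarrow> nat \<Rightarrow> int \<Rightarrow> int \<Rightarrow> pos list set" where
  "V L k i j = snd ` W L k i j"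

definition ff :: "pos list \<Rightarrow> nat \<Rightarrow> int \<Rightarrow> int \<Rightarrow> enat" where
  "ff L k i j = Sup ((\<lambda>x. enat (length x)) ` U L k i j)"

definition gg :: "pos list \<Rightarrow> nat \<Rightarrow> int \<Rightarrow> int \<Rightarrow> enat" where
  "gg L k i j = Sup ((\<lambda>x. enat (length x)) ` V L k i j)"

text \<open>T-tilde; here r = -k and s = length L - 1 - k.\<close>
definition Ttilde :: "pos list \<Rightarrow> nat \<Rightarrow> enat" where
  "Ttilde L k = Min ((\<lambda>(i,j). max (enat (nat (-2*i + j)) + gg L k i j)
                                   (enat (nat (2*j - i)) + ff L k i j))
                     ` ({- int k..0} \<times> {0..int (length L) - 1 - int k}))"

end

(* Let (i, j) attain the minimum and assume that the value T is finite. For T steps, the nodes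
   flood the facts "position p is occupied and has boundary condition b", kept only if the fact
   lies in the finite set D of those that hold in C for p_i, ..., p_j. The fact about p_m reaches
   p_l exactly at time |m| + |m - l|. If all of D holds in a configuration, then, because a path
   inside an induced path can only be traversed monotonically, the configuration is
   x_0 p_i ... p_j x_1 with (x_0, x_1) in W(i, j), up to reversal; the bounds |x_0| <= f and
   |x_1| <= g then say precisely that every node knows D at time T, and all fire at time T. If D
   fails, no node knows D at time T; the nodes return to the quiescent state and a general-purpose
   squad starts, whose running time is irrelevant.

   That squad first sends a signal to one end of the path and a wave back that orients all nodes.
   Its line algorithm is symmetric. All generals emit, to both sides, signals of speed 1 and 1/2.
   Between two generals at distance g, the speed-1 signals hit the opposite generals at the same
   time g at which the speed-1/2 signals meet in the middle and create new generals there. So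
   every gap g is replaced by gaps g div 2, simultaneously everywhere, until all cells are
   generals. Reflecting ends reduce a line of n cells with one general at its end to a gap
   2n - 1 on a bi-infinite line. *)
theory Submission
  imports Defs
begin

section \<open>Synchronizing a line\<close>

text \<open>\<open>G0\<close>, \<open>G1\<close>, \<open>G2\<close> are generals in round time 0, 1 and later. The arguments of \<open>N\<close> are independent
  tracks: a speed-1 signal moving right, one moving left, and likewise for speed 1/2, where
  the Boolean is the half-step already made inside the cell.\<close>
datatype cell = G0 | G1 | G2 | Fired | N bool bool "bool option" "bool option"

fun fastR :: "cell \<Rightarrow> bool" where
  "fastR G0 = True" | "fastR (N r l a b) = r" | "fastR _ = False"
fun fastL :: "cell \<Rightarrow> bool" where
  "fastL G0 = True" | "fastL (N r l a b) = l" | "fastL _ = False"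
fun slowR :: "cell \<Rightarrow> bool option" where
  "slowR G1 = Some True" | "slowR (N r l a b) = a" | "slowR _ = None"
fun slowL :: "cell \<Rightarrow> bool option" where
  "slowL G1 = Some True" | "slowL (N r l a b) = b" | "slowL _ = None"

text \<open>A signal of speed 1/2 spends two steps in a cell: it enters as
  \<open>Some False\<close>, turns into \<open>Some True\<close>, and then leaves.\<close>

fun advance :: "bool option \<Rightarrow> bool option \<Rightarrow> bool option" where
  "advance inc cur = (if inc = Some True then Some False
     else if cur = Some False then Some True else None)"

text \<open>Two slow signals meet either by entering one cell from both sides (even gap) or by
  facing each other in adjacent cells (odd gap), which then both become generals. For generals, the
  tests \<open>l \<noteq> G0\<close> and \<open>r \<noteq> G0\<close> prevent the emission of an
  adjacent general from being taken for an arriving signal; this makes gaps of length 1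
  inert.\<close>

fun cell_step :: "cell \<Rightarrow> cell \<Rightarrow> cell \<Rightarrow> cell" where
  "cell_step l (N r' l' a b) r =
    (if slowR l = Some True \<and> slowL r = Some True \<or>
        a = Some False \<and> slowL r = Some False \<or> b = Some False \<and> slowR l = Some False
     then G0
     else N (fastR l) (fastL r) (advance (slowR l) a) (advance (slowL r) b))"
| "cell_step l c r =
    (if c = Fired \<or> l = G0 \<and> c = G0 \<and> r = G0 then Fired
     else if l \<noteq> G0 \<and> fastR l \<or> r \<noteq> G0 \<and> fastL r then G0
     else if c = G0 then G1 else G2)"

definition line_step :: "(int \<Rightarrow> cell) \<Rightarrow> int \<Rightarrow> cell" where
  "line_step c x = cell_step (c (x - 1)) (c x) (c (x + 1))"

text \<open>The cell at offset \<open>y\<close> between two generals at distance \<open>g\<close>, at time \<open>t\<close> of the round.\<close>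
definition gap_cell :: "int \<Rightarrow> int \<Rightarrow> int \<Rightarrow> cell" where
  "gap_cell g t y =
    (if y = 0 \<or> y = g then (if t = 0 then G0 else if t = 1 then G1 else G2)
     else N (y = t) (g - y = t)
       (if y = t div 2 then Some (odd t) else None)
       (if g - y = t div 2 then Some (odd t) else None))"

definition gap_at :: "int \<Rightarrow> int \<Rightarrow> (int \<Rightarrow> cell) \<Rightarrow> int \<Rightarrow> bool" where
  "gap_at g t c a \<longleftrightarrow> (\<forall>y. 0 \<le> y \<longrightarrow> y \<le> g \<longrightarrow> c (a + y) = gap_cell g t y)"

text \<open>For odd \<open>g\<close> a round ends with two adjacent generals in the middle, so gaps of length 1 may
  occur besides those of length \<open>g\<close>; they are inert, and the covering below leaves them out.\<close>
definition gaps :: "int \<Rightarrow> int \<Rightarrow> (int \<Rightarrow> cell) \<Rightarrow> bool" where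
  "gaps g t c \<longleftrightarrow> (\<forall>x. \<exists>a. a \<le> x \<and> x \<le> a + g \<and> gap_at g t c a)"

definition is_general :: "cell \<Rightarrow> bool" where
  "is_general c \<longleftrightarrow> c = G0 \<or> c = G1 \<or> c = G2"

lemma is_general_gap_cell: "is_general (gap_cell g t y) \<longleftrightarrow> y = 0 \<or> y = g"
  by (simp add: gap_cell_def is_general_def)

lemma gap_at_D: "gap_at g t c a \<Longrightarrow> a \<le> x \<Longrightarrow> x \<le> a + g \<Longrightarrow> c x = gap_cell g t (x - a)"
  unfolding gap_at_def by (metis add.commute diff_add_cancel diff_ge_0_iff_ge diff_le_eq)

text \<open>The left neighbour lies in some gap of the covering. Generals occur only at the ends of
  a gap, so that gap ends either at \<open>a\<close> or just before it; thus whatever can reach the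
  general from outside is known.\<close>

lemma gaps_left:
  assumes "gaps g t c" and "gap_at g t c a" and "1 \<le> g"
  shows "c (a - 1) = gap_cell g t (g - 1) \<or> is_general (c (a - 1))"
proof -
  obtain b where b: "b \<le> a - 1" "a - 1 \<le> b + g" "gap_at g t c b"
    using assms(1) unfolding gaps_def by blast
  show ?thesis
  proof (cases "a - 1 = b + g")
    case True
    then show ?thesis using gap_at_D[OF b(3), of "a - 1"] b assms by (simp add: is_general_gap_cell)
  next
    case False
    then have "c a = gap_cell g t (a - b)" using gap_at_D[OF b(3), of a] b by simp
    moreover have "is_general (c a)"
      using gap_at_D[OF assms(2), of a] assms by (simp add: is_general_gap_cell)
    ultimately have "a - b = g" using b by (auto simp: is_general_gap_cell)
    then show ?thesis using gap_at_D[OF b(3), of "a - 1"] b by (simp add: algebra_simps)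
  qed
qed

lemma gaps_right:
  assumes "gaps g t c" and "gap_at g t c a" and "1 \<le> g"
  shows "c (a + g + 1) = gap_cell g t 1 \<or> is_general (c (a + g + 1))"
proof -
  obtain b where b: "b \<le> a + g + 1" "a + g + 1 \<le> b + g" "gap_at g t c b"
    using assms(1) unfolding gaps_def by blast
  show ?thesis
  proof (cases "a + g + 1 = b")
    case True
    then show ?thesis using gap_at_D[OF b(3), of "a + g + 1"] b assms by (simp add: is_general_gap_cell)
  next
    case False
    then have "c (a + g) = gap_cell g t (a + g - b)" using gap_at_D[OF b(3), of "a + g"] b by simp
    moreover have "is_general (c (a + g))"
      using gap_at_D[OF assms(2), of "a + g"] assms by (simp add: is_general_gap_cell)
    ultimately have "a + g = b" using b by (auto simp: is_general_gap_cell)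
    then show ?thesis using gap_at_D[OF b(3), of "a + g + 1"] b by (simp add: algebra_simps)
  qed
qed

text \<open>A fast signal from the adjoining gap can arrive only in the last step of the round,
  together with the one from inside, so both gaps agree on their common general. For
  \<open>2 \<le> g\<close> the inner neighbour is no general, which rules out firing.\<close>

lemma line_step_left_general:
  assumes "gaps g t c" and "gap_at g t c a" and "2 \<le> g" and "0 \<le> t" "t < g"
  shows "line_step c a = (if t + 1 = g then G0 else gap_cell g (t + 1) 0)"
proof -
  have "c a = gap_cell g t 0" "c (a + 1) = gap_cell g t 1"
    using gap_at_D[OF assms(2), of a] gap_at_D[OF assms(2), of "a + 1"] assms by auto
  with gaps_left[OF assms(1,2)] assms(3-) show ?thesis
    by (auto simp: line_step_def gap_cell_def is_general_def)
qed

lemma line_step_right_general: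
  assumes "gaps g t c" and "gap_at g t c a" and "2 \<le> g" and "0 \<le> t" "t < g"
  shows "line_step c (a + g) = (if t + 1 = g then G0 else gap_cell g (t + 1) g)"
proof -
  have "c (a + g) = gap_cell g t g" "c (a + g - 1) = gap_cell g t (g - 1)"
    using gap_at_D[OF assms(2), of "a + g"] gap_at_D[OF assms(2), of "a + g - 1"] assms by auto
  with gaps_right[OF assms(1,2)] assms(3-) show ?thesis
    by (auto simp: line_step_def gap_cell_def is_general_def)
qed

text \<open>The generals fit the pattern of the inner cells: at distance 0, \<open>G0\<close> acts
  as a fast signal and \<open>G1\<close> as a slow one with its half-step made. Only at time 0 is
  the slow signal missing, whence \<open>y \<noteq> 0\<close> and
  \<open>y \<noteq> g\<close>.\<close>

lemma gap_cell_signals: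
  assumes "0 \<le> t" "t < g"
  shows "y < g \<Longrightarrow> 0 \<le> y \<Longrightarrow> fastR (gap_cell g t y) \<longleftrightarrow> y = t"
    and "0 < y \<Longrightarrow> y \<le> g \<Longrightarrow> fastL (gap_cell g t y) \<longleftrightarrow> g - y = t"
    and "y < g \<Longrightarrow> 0 \<le> y \<Longrightarrow> slowR (gap_cell g t y) = Some True \<longleftrightarrow> y = t div 2 \<and> odd t"
    and "0 < y \<Longrightarrow> y \<le> g \<Longrightarrow> slowL (gap_cell g t y) = Some True \<longleftrightarrow> g - y = t div 2 \<and> odd t"
    and "y < g \<Longrightarrow> 0 \<le> y \<Longrightarrow> slowR (gap_cell g t y) = Some False \<longleftrightarrow> y = t div 2 \<and> even t \<and> y \<noteq> 0"
    and "0 < y \<Longrightarrow> y \<le> g \<Longrightarrow> slowL (gap_cell g t y) = Some False \<longleftrightarrow> g - y = t div 2 \<and> even t \<and> y \<noteq> g"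
  using assms by (auto simp: gap_cell_def)

text \<open>The slow signals stand at offsets \<open>t div 2\<close> and \<open>g - t div 2\<close>.
  They meet exactly in the step to time \<open>g\<close>: in one cell if \<open>t\<close> is odd, in
  two adjacent cells if \<open>t\<close> is even.\<close>

lemma line_step_inner:
  assumes "gap_at g t c a" and t: "0 \<le> t" "t < g" and y: "0 < y" "y < g"
  shows "line_step c (a + y) =
    (if t + 1 = g then if y = g div 2 \<or> y = g - g div 2 then G0 else N False False None None
     else gap_cell g (t + 1) y)"
proof -
  let ?l = "gap_cell g t (y - 1)" and ?r = "gap_cell g t (y + 1)"
  have c: "c (a + y) = gap_cell g t y" "c (a + y - 1) = ?l" "c (a + y + 1) = ?r"
    using gap_at_D[OF assms(1), of "a + y"] gap_at_D[OF assms(1), of "a + y - 1"]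
      gap_at_D[OF assms(1), of "a + y + 1"] t y by auto
  have l: "fastR ?l \<longleftrightarrow> y - 1 = t" "slowR ?l = Some True \<longleftrightarrow> y - 1 = t div 2 \<and> odd t"
    "slowR ?l = Some False \<longleftrightarrow> y - 1 = t div 2 \<and> even t \<and> y - 1 \<noteq> 0"
    using gap_cell_signals[OF t, of "y - 1"] y by auto
  have r: "fastL ?r \<longleftrightarrow> g - y - 1 = t" "slowL ?r = Some True \<longleftrightarrow> g - y - 1 = t div 2 \<and> odd t"
    "slowL ?r = Some False \<longleftrightarrow> g - y - 1 = t div 2 \<and> even t \<and> y + 1 \<noteq> g"
    using gap_cell_signals(2,4,6)[OF t, of "y + 1"] y by (simp_all add: diff_diff_eq)
  have m: "gap_cell g t y = N (y = t) (g - y = t)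
       (if y = t div 2 then Some (odd t) else None) (if g - y = t div 2 then Some (odd t) else None)"
    using y by (simp add: gap_cell_def)
  have a: "(if y = t div 2 then Some (odd t) else None) = Some False \<longleftrightarrow> y = t div 2 \<and> even t"
    and b: "(if g - y = t div 2 then Some (odd t) else None) = Some False \<longleftrightarrow> g - y = t div 2 \<and> even t"
    by simp_all
  have step: "line_step c (a + y) =
    (if (y - 1 = t div 2 \<and> odd t) \<and> g - y - 1 = t div 2 \<and> odd t \<or>
        (y = t div 2 \<and> even t) \<and> g - y - 1 = t div 2 \<and> even t \<and> y + 1 \<noteq> g \<or>
        (g - y = t div 2 \<and> even t) \<and> y - 1 = t div 2 \<and> even t \<and> y - 1 \<noteq> 0
     then G0
     else N (y - 1 = t) (g - y - 1 = t)
      (if y - 1 = t div 2 \<and> odd t then Some False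
       else if y = t div 2 \<and> even t then Some True else None)
      (if g - y - 1 = t div 2 \<and> odd t then Some False
       else if g - y = t div 2 \<and> even t then Some True else None))"
    by (simp only: line_step_def c m cell_step.simps l r advance.simps a b)
  obtain h where "t = 2 * h \<or> t = 2 * h + 1" by (metis evenE oddE)
  then show ?thesis
  proof
    assume h: "t = 2 * h"
    have d: "(2 * h + 1) div 2 = h" by simp
    show ?thesis
    proof (cases "t + 1 = g")
      case True
      then have g: "g = 2 * h + 1" using h by simp
      show ?thesis unfolding step using t y by (simp add: h g d; presburger)
    next
      case False
      \<comment> \<open>Before the last step of the round the slow signals are too far apart to
        meet.\<close>
      then have "\<not> (y = h \<and> g - y - 1 = h)" "\<not> (g - y = h \<and> y - 1 = h)" using h by auto
      moreover have "y - 1 = t \<longleftrightarrow> y = t + 1" "g - y - 1 = t \<longleftrightarrow> g - y = t + 1" by auto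
      ultimately show ?thesis
        unfolding step using False t y by (simp add: gap_cell_def h d)
    qed
  next
    assume h: "t = 2 * h + 1"
    have d: "(2 * h + 1) div 2 = h"  "(2 * h + 2) div 2 = h + 1" by simp_all
    show ?thesis
    proof (cases "t + 1 = g")
      case True
      then have g: "g = 2 * h + 2" using h by simp
      show ?thesis unfolding step using t y by (simp add: h g d; presburger)
    next
      case False
      then have "\<not> (y - 1 = h \<and> g - y - 1 = h)" using h by auto
      moreover have "y - 1 = t \<longleftrightarrow> y = t + 1" "g - y - 1 = t \<longleftrightarrow> g - y = t + 1"
        "y - 1 = h \<longleftrightarrow> y = h + 1" "g - y - 1 = h \<longleftrightarrow> g - y = h + 1" by auto
      ultimately show ?thesis
        unfolding step using False t y by (simp add: gap_cell_def h d)
    qed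
  qed
qed

lemma gaps_step:
  assumes "gaps g t c" and "2 \<le> g" and "0 \<le> t" "t + 1 < g"
  shows "gaps g (t + 1) (line_step c)"
  unfolding gaps_def
proof
  fix x
  obtain a where a: "a \<le> x" "x \<le> a + g" "gap_at g t c a"
    using assms(1) unfolding gaps_def by blast
  have "line_step c (a + y) = gap_cell g (t + 1) y" if y: "0 \<le> y" "y \<le> g" for y
  proof -
    consider "y = 0" | "y = g" | "0 < y" "y < g" using y by linarith
    then show ?thesis
    proof cases
      case 1
      then show ?thesis using line_step_left_general[OF assms(1) a(3)] assms by simp
    next
      case 2
      then show ?thesis using line_step_right_general[OF assms(1) a(3)] assms by simp
    next
      case 3
      then show ?thesis using line_step_inner[OF a(3)] assms by simp
    qed
  qed
  then show "\<exists>a. a \<le> x \<and> x \<le> a + g \<and> gap_at g (t + 1) (line_step c) a"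
    using a unfolding gap_at_def by blast
qed

lemma gaps_halve:
  assumes "gaps g (g - 1) c" and "2 \<le> g"
  shows "gaps (g div 2) 0 (line_step c)"
  unfolding gaps_def
proof
  fix x
  obtain a where a: "a \<le> x" "x \<le> a + g" "gap_at g (g - 1) c a"
    using assms(1) unfolding gaps_def by blast
  let ?m = "g div 2"
  have m: "1 \<le> ?m" "2 * ?m \<le> g" "g \<le> 2 * ?m + 1" using assms(2) by linarith+
  have v: "line_step c (a + y) =
      (if y = 0 \<or> y = g \<or> y = ?m \<or> y = g - ?m then G0 else N False False None None)"
    if y: "0 \<le> y" "y \<le> g" for y
  proof -
    consider "y = 0" | "y = g" | "0 < y" "y < g" using y by linarith
    then show ?thesis
    proof cases
      case 1
      then show ?thesis using line_step_left_general[OF assms(1) a(3)] assms by simp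
    next
      case 2
      then show ?thesis using line_step_right_general[OF assms(1) a(3)] assms by simp
    next
      case 3
      then show ?thesis using line_step_inner[OF a(3)] assms by simp
    qed
  qed
  \<comment> \<open>The two halves share the new general if \<open>g\<close> is even. If
    \<open>g\<close> is odd, a gap of length 1 separates them, but its two cells are ends of the
    halves, so the old gap is still covered.\<close>
  have "gap_at ?m 0 (line_step c) a"
    unfolding gap_at_def
  proof (intro allI impI)
    fix y assume y: "0 \<le> y" "y \<le> ?m"
    then have "y = g \<or> y = g - ?m \<longrightarrow> y = ?m" using m by linarith
    then show "line_step c (a + y) = gap_cell ?m 0 y"
      using v[of y] y m by (auto simp: gap_cell_def)
  qed
  moreover have "gap_at ?m 0 (line_step c) (a + g - ?m)"
    unfolding gap_at_def
  proof (intro allI impI)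
    fix y assume y: "0 \<le> y" "y \<le> ?m"
    let ?z = "g - ?m + y"
    have "?z = 0 \<or> ?z = g \<or> ?z = ?m \<or> ?z = g - ?m \<longleftrightarrow> y = 0 \<or> y = ?m"
      using m y by linarith
    moreover have "0 \<le> ?z" "?z \<le> g" using m y by linarith+
    moreover have e: "a + g - ?m + y = a + ?z" by simp
    ultimately have "line_step c (a + g - ?m + y) =
        (if y = 0 \<or> y = ?m then G0 else N False False None None)"
      unfolding e by (simp only: v)
    then show "line_step c (a + g - ?m + y) = gap_cell ?m 0 y"
      by (simp add: gap_cell_def)
  qed
  moreover have "x \<le> a + ?m \<or> a + g - ?m \<le> x" using m by linarith
  ultimately show "\<exists>b. b \<le> x \<and> x \<le> b + ?m \<and> gap_at ?m 0 (line_step c) b"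
    using a by (metis add_diff_cancel diff_add_cancel)
qed

lemma gaps_not_Fired: "gaps g t c \<Longrightarrow> c x \<noteq> Fired"
  unfolding gaps_def using gap_at_D by (metis cell.distinct(5,11,15,19) gap_cell_def)

lemma gaps_round:
  assumes "gaps g 0 c" and "2 \<le> g" and "int t < g"
  shows "gaps g (int t) ((line_step ^^ t) c)"
  using assms(3)
proof (induction t)
  case (Suc t)
  then show ?case using gaps_step[OF Suc.IH] assms(2) by (simp add: add.commute)
qed (use assms in simp)

text \<open>Strong induction on the gap length: a round of \<open>g\<close> steps leads to gaps
  \<open>g div 2\<close>, and for \<open>g = 1\<close> every cell is in \<open>G0\<close>, so that
  all fire in the next step.\<close>

lemma gaps_synchronize:
  assumes "gaps g 0 c" and "1 \<le> g"
  shows "\<exists>t. (\<forall>x. (line_step ^^ t) c x = Fired) \<and> (\<forall>u<t. \<forall>x. (line_step ^^ u) c x \<noteq> Fired)"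
  using assms
proof (induction "nat g" arbitrary: g c rule: less_induct)
  case less
  show ?case
  proof (cases "g = 1")
    case True
    have "c x = G0" for x
    proof -
      obtain a where "a \<le> x" "x \<le> a + g" "gap_at g 0 c a"
        using less.prems unfolding gaps_def by blast
      then show ?thesis using gap_at_D[of g 0 c a x] True by (auto simp: gap_cell_def)
    qed
    then show ?thesis by (intro exI[of _ 1]) (simp add: line_step_def)
  next
    case False
    then have g: "2 \<le> g" using less.prems by simp
    let ?c = "(line_step ^^ nat g) c"
    have "gaps g (g - 1) ((line_step ^^ nat (g - 1)) c)"
      using gaps_round[OF less.prems(1) g, of "nat (g - 1)"] g by simp
    moreover have "nat g = Suc (nat (g - 1))" using g by simp
    ultimately have "gaps (g div 2) 0 ?c" using gaps_halve g by simp
    moreover have "nat (g div 2) < nat g" "1 \<le> g div 2" using g by simp_all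
    ultimately obtain t where t: "\<forall>x. (line_step ^^ t) ?c x = Fired"
        "\<forall>u<t. \<forall>x. (line_step ^^ u) ?c x \<noteq> Fired"
      using less.hyps by meson
    show ?thesis
    proof (intro exI[of _ "t + nat g"] conjI allI impI)
      show "(line_step ^^ (t + nat g)) c x = Fired" for x
        using t(1) by (simp add: funpow_add)
      show "(line_step ^^ u) c x \<noteq> Fired" if "u < t + nat g" for u x
      proof (cases "u < nat g")
        case True
        then show ?thesis using gaps_not_Fired[OF gaps_round[OF less.prems(1) g, of u]] by auto
      next
        case False
        then have "(line_step ^^ u) c = (line_step ^^ (u - nat g)) ?c"
          by (metis add_diff_inverse_nat add.commute comp_apply funpow_add)
        then show ?thesis using t(2) that False by simp
      qed
    qed
  qed
qed

section \<open>Finite lines with reflecting ends\<close>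

fun mirror :: "cell \<Rightarrow> cell" where
  "mirror (N r l a b) = N l r b a" | "mirror c = c"

text \<open>This symmetry lets a cell at an end of the line use its own mirror image in place of the
  missing neighbour.\<close>

lemma cell_step_mirror: "cell_step (mirror r) (mirror c) (mirror l) = mirror (cell_step l c r)"
proof -
  have [simp]: "fastR (mirror x) = fastL x" "fastL (mirror x) = fastR x"
    "slowR (mirror x) = slowL x" "slowL (mirror x) = slowR x"
    "mirror x = G0 \<longleftrightarrow> x = G0" for x by (cases x; simp)+
  show ?thesis by (cases c) auto
qed

text \<open>A line of \<open>n\<close> cells with reflecting ends unfolds to a bi-infinite line of period \<open>2 * n\<close>;
  in the unfolding, a single general at the left end yields generals at distance \<open>2 * n - 1\<close>.\<close>
definition reflecting :: "nat \<Rightarrow> (int \<Rightarrow> cell) \<Rightarrow> bool" where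
  "reflecting n c \<longleftrightarrow> (\<forall>x. c (-1 - x) = mirror (c x) \<and> c (2 * int n - 1 - x) = mirror (c x))"

lemma reflecting_line_step:
  assumes "reflecting n c"
  shows "reflecting n (line_step c)"
proof -
  have "line_step c (d - 1 - x) = mirror (line_step c x)"
    if "\<And>x. c (d - 1 - x) = mirror (c x)" for d x
    unfolding line_step_def cell_step_mirror[symmetric]
    using that[of x] that[of "x + 1"] that[of "x - 1"] by (simp add: algebra_simps)
  from this[of 0] this[of "2 * int n"] assms show ?thesis
    by (simp add: reflecting_def)
qed

text \<open>The general at 0 has its mirror image at -1, so modulo \<open>2 * n\<close> the generals
  are the residues 0 and -1; they bound gaps of lengths \<open>2 * n - 1\<close> and 1.\<close>

definition start_line :: "nat \<Rightarrow> int \<Rightarrow> cell" where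
  "start_line n x = (if x mod (2 * int n) = 0 \<or> (x + 1) mod (2 * int n) = 0 then G0
     else N False False None None)"

lemma reflecting_start_line: "reflecting n (start_line n)"
proof -
  have *: "int n * 2 dvd - 1 - x \<longleftrightarrow> int n * 2 dvd x + 1" "int n * 2 dvd - x \<longleftrightarrow> int n * 2 dvd x"
    "int n * 2 dvd int n * 2 - 1 - x \<longleftrightarrow> int n * 2 dvd x + 1"
    "int n * 2 dvd int n * 2 - x \<longleftrightarrow> int n * 2 dvd x" for x
    using dvd_minus_iff[of "int n * 2" "x + 1"] dvd_diff_right_iff dvd_minus_iff[of "int n * 2" x] 
       dvd_add_right_iff[of "int n * 2" "int n * 2" "- 1 - x"]
       dvd_add_right_iff[of "int n * 2" "int n * 2" "- x"]
    by (simp_all add: algebra_simps)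
  show ?thesis
    unfolding reflecting_def start_line_def mod_eq_0_iff_dvd
    by (simp add: mult.commute[of 2] *)
qed

lemma gaps_start_line:
  assumes "1 \<le> n"
  shows "gaps (2 * int n - 1) 0 (start_line n)"
  unfolding gaps_def
proof
  fix x
  \<comment> \<open>The period containing \<open>x\<close> is itself a gap: its first and last cells
    are generals.\<close>
  let ?P = "2 * int n" and ?a = "2 * int n * (x div (2 * int n))"
  have 1: "?a \<le> x" "x \<le> ?a + (?P - 1)"
    using assms pos_mod_bound[of ?P x] pos_mod_sign[of ?P x] mult_div_mod_eq[of ?P x] by linarith+
  have "gap_at (?P - 1) 0 (start_line n) ?a"
    unfolding gap_at_def
  proof (intro allI impI)
    fix y assume y: "0 \<le> y" "y \<le> ?P - 1"
    have "(?a + y) mod ?P = y" using y by simp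
    moreover have "(?a + y + 1) mod ?P = (y + 1) mod ?P"
      by (simp add: add.assoc)
    moreover have "(y + 1) mod ?P = 0 \<longleftrightarrow> y = ?P - 1"
      using y by (cases "y = ?P - 1") (auto simp: mod_pos_pos_trivial)
    ultimately show "start_line n (?a + y) = gap_cell (?P - 1) 0 y"
      using y by (simp add: start_line_def gap_cell_def)
  qed
  then show "\<exists>a. a \<le> x \<and> x \<le> a + (?P - 1) \<and> gap_at (?P - 1) 0 (start_line n) a"
    using 1 by blast
qed

lemma start_line_nth:
  assumes "x < n"
  shows "start_line n (int x) = (if x = 0 then G0 else N False False None None)"
  using assms by (auto simp: start_line_def)

section \<open>Encoding automata and the geometry of paths\<close>

text \<open>The model is restated over an arbitrary state type, so that the automaton can be built
  from structured states and encoded by numbers once and for all.\<close>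

definition inputs :: "pos set \<Rightarrow> (pos \<Rightarrow> 'a) \<Rightarrow> pos \<Rightarrow> 'a option list" where
  "inputs P \<sigma> p = map (\<lambda>i. if padd p (eps i) \<in> P then Some (\<sigma> (padd p (eps i))) else None) [0..<4]"

definition global_step :: "('a \<Rightarrow> 'a option list \<Rightarrow> 'a) \<Rightarrow> pos set \<Rightarrow> (pos \<Rightarrow> 'a) \<Rightarrow> pos \<Rightarrow> 'a" where
  "global_step \<delta> P \<sigma> p = \<delta> (\<sigma> p) (inputs P \<sigma> p)"

definition global_init :: "(bool list \<Rightarrow> 'a) \<Rightarrow> 'a \<Rightarrow> pos set \<Rightarrow> pos \<Rightarrow> 'a" where
  "global_init init q P p = (if p = (0,0) then init (bc P (0,0)) else q)"

definition fires_in ::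
  "('a \<Rightarrow> 'a option list \<Rightarrow> 'a) \<Rightarrow> 'a set \<Rightarrow> pos set \<Rightarrow> (pos \<Rightarrow> 'a) \<Rightarrow> nat \<Rightarrow> bool" where
  "fires_in \<delta> F P \<sigma> t \<longleftrightarrow>
    (\<forall>u<t. \<forall>p\<in>P. (global_step \<delta> P ^^ u) \<sigma> p \<notin> F) \<and> (\<forall>p\<in>P. (global_step \<delta> P ^^ t) \<sigma> p \<in> F)"

lemma funpow_global_step_Suc:
  "(global_step \<delta> P ^^ Suc t) \<sigma> p =
    \<delta> ((global_step \<delta> P ^^ t) \<sigma> p) (inputs P ((global_step \<delta> P ^^ t) \<sigma>) p)"
  unfolding funpow.simps comp_apply by (rule global_step_def)

lemma length_inputs [simp]: "length (inputs P \<sigma> p) = 4"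
  by (simp add: inputs_def)

lemma inputs_cong: "(\<And>p. p \<in> P \<Longrightarrow> \<sigma> p = \<sigma>' p) \<Longrightarrow> inputs P \<sigma> p = inputs P \<sigma>' p"
  by (simp add: inputs_def)

lemma funpow_global_step_cong:
  assumes "\<And>p. p \<in> P \<Longrightarrow> \<sigma> p = \<sigma>' p" and "p \<in> P"
  shows "(global_step \<delta> P ^^ t) \<sigma> p = (global_step \<delta> P ^^ t) \<sigma>' p"
  using assms(2)
proof (induction t arbitrary: p)
  case (Suc t)
  then show ?case
    using inputs_cong[of P "(global_step \<delta> P ^^ t) \<sigma>" "(global_step \<delta> P ^^ t) \<sigma>'" p]
    unfolding funpow_global_step_Suc by simp
qed (use assms(1) in simp)

text \<open>Chains the phases of the squad: a silent initial phase only delays the firing.\<close>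

lemma fires_in_add:
  assumes "\<And>u p. u < s \<Longrightarrow> p \<in> P \<Longrightarrow> (global_step \<delta> P ^^ u) \<sigma> p \<notin> F"
    and "\<And>p. p \<in> P \<Longrightarrow> (global_step \<delta> P ^^ s) \<sigma> p = \<sigma>' p"
    and "fires_in \<delta> F P \<sigma>' t"
  shows "fires_in \<delta> F P \<sigma> (t + s)"
proof -
  have e: "(global_step \<delta> P ^^ (u + s)) \<sigma> p = (global_step \<delta> P ^^ u) \<sigma>' p" if "p \<in> P" for u p
    using funpow_global_step_cong[of P "(global_step \<delta> P ^^ s) \<sigma>" \<sigma>' p u \<delta>] assms(2) that
    by (simp add: funpow_add)
  show ?thesis
    unfolding fires_in_def
  proof (intro conjI allI impI ballI)
    fix u p assume u: "u < t + s" "p \<in> P"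
    show "(global_step \<delta> P ^^ u) \<sigma> p \<notin> F"
    proof (cases "u < s")
      case False
      then show ?thesis
        using e[OF u(2), of "u - s"] assms(3) u by (auto simp: fires_in_def)
    qed (use assms(1) u in simp)
  qed (use e assms(3) in \<open>simp add: fires_in_def\<close>)
qed

text \<open>An injection of the finite set \<open>S\<close> into the naturals carries the automaton
  over; the run never leaves \<open>S\<close>, where decoding inverts the injection.\<close>

lemma encode_automaton:
  fixes \<delta> :: "'a \<Rightarrow> 'a option list \<Rightarrow> 'a"
  assumes "finite S" and "q \<in> S" and init: "\<And>b. length b = 4 \<Longrightarrow> init b \<in> S"
    and "q \<notin> F"
    and closed: "\<And>s ns. s \<in> S \<Longrightarrow> length ns = 4 \<Longrightarrow> set ns \<subseteq> insert None (Some ` S) \<Longrightarrow> \<delta> s ns \<in> S"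
    and quiescent: "\<And>ns. length ns = 4 \<Longrightarrow> set ns \<subseteq> {None, Some q} \<Longrightarrow> \<delta> q ns = q"
  shows "\<exists>A. wf_fsa A \<and>
    (\<forall>L t. fires_at A L t \<longleftrightarrow> fires_in \<delta> F (set L) (global_init init q (set L)) t)"
proof -
  obtain f :: "'a \<Rightarrow> nat" where f: "inj_on f S"
    using finite_imp_inj_to_nat_seg[OF assms(1)] by blast
  define g where "g = inv_into S f"
  have gf: "g (f s) = s" if "s \<in> S" for s using f that by (simp add: g_def)
  \<comment> \<open>One general state is listed for each boundary condition and \<open>tau\<close>
    returns its index, so the initial state may depend on the whole boundary condition.\<close>
  define Bs where "Bs = List.n_lists 4 [False, True]"
  have Bs: "set Bs = {b. length b = 4}"
    unfolding Bs_def set_n_lists by (auto simp: bool.expand)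
  define enc where "enc b = (SOME k. k < length Bs \<and> Bs ! k = b)" for b
  have enc: "enc b < length Bs \<and> Bs ! enc b = b" if "length b = 4" for b
  proof -
    have "b \<in> set Bs" using Bs that by simp
    then show ?thesis unfolding enc_def by (intro someI_ex[of "\<lambda>k. k < length Bs \<and> Bs ! k = b"]) (simp add: in_set_conv_nth)
  qed
  define A where "A = \<lparr>St = f ` S, Qst = f q, Gst = map (f \<circ> init) Bs, Fst = f ` (F \<inter> S), tau = enc,
    delta = (\<lambda>s ns. f (\<delta> (g s) (map (map_option g) ns)))\<rparr>"
  have "delta A s ns \<in> St A"
    if "s \<in> St A" "length ns = 4" "set ns \<subseteq> insert None (Some ` St A)" for s ns
  proof -
    have "set (map (map_option g) ns) \<subseteq> insert None (Some ` S)"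
      using that(3) gf by (fastforce simp: A_def)
    then show ?thesis using that closed gf by (auto simp: A_def)
  qed
  moreover have "delta A (Qst A) ns = Qst A"
    if "length ns = 4" "set ns \<subseteq> {None, Some (Qst A)}" for ns
  proof -
    have "set (map (map_option g) ns) \<subseteq> {None, Some q}"
      using that(2) gf[OF assms(2)] by (auto simp: A_def)
    then show ?thesis using that quiescent gf[OF assms(2)] by (simp add: A_def)
  qed
  moreover have "f q \<notin> f ` (F \<inter> S)"
    using assms(2,4) f by (simp add: inj_on_image_mem_iff)
  moreover have "Bs \<noteq> []" using enc[of "replicate 4 False"] by auto
  moreover have "set (Gst A) \<subseteq> St A" using init Bs by (auto simp: A_def)
  ultimately have wf: "wf_fsa A"
    using assms enc unfolding wf_fsa_def by (simp add: A_def image_mono)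
  have delta_A: "delta A s ns = f (\<delta> (g s) (map (map_option g) ns))" for s ns
    by (simp add: A_def)
  have run: "run A P t p = f ((global_step \<delta> P ^^ t) (global_init init q P) p) \<and>
      (global_step \<delta> P ^^ t) (global_init init q P) p \<in> S" for P t p
  proof (induction t arbitrary: p)
    case 0
    have "length (bc P (0,0)) = 4" by (simp add: bc_def)
    with enc[of "bc P (0,0)"] init[of "bc P (0,0)"] assms(2) show ?case
      by (simp add: global_init_def A_def)
  next
    case (Suc t)
    let ?\<sigma> = "(global_step \<delta> P ^^ t) (global_init init q P)"
    have S: "?\<sigma> r \<in> S" for r using Suc by blast
    have "map (map_option g) (map (\<lambda>i. if padd p (eps i) \<in> P
        then Some (run A P t (padd p (eps i))) else None) [0..<4]) = inputs P ?\<sigma> p"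
      using Suc gf by (simp add: inputs_def)
    moreover have "set (inputs P ?\<sigma> p) \<subseteq> insert None (Some ` S)"
      by (simp add: inputs_def image_subset_iff S)
    then have "\<delta> (?\<sigma> p) (inputs P ?\<sigma> p) \<in> S" using closed[OF S] by simp
    moreover have "run A P t p = f (?\<sigma> p)" using Suc by blast
    ultimately show ?case using gf[OF S]
      unfolding funpow_global_step_Suc by (simp add: delta_A del: map_map)
  qed
  have fst: "run A P t p \<in> Fst A \<longleftrightarrow> (global_step \<delta> P ^^ t) (global_init init q P) p \<in> F" for P t p
    using run[of P t p] inj_on_image_mem_iff[OF f, of _ "F \<inter> S"] by (simp add: A_def)
  show ?thesis
    by (intro exI[of _ A] conjI wf) (simp only: fires_at_def fires_in_def fst simp_thms)
qed

section \<open>Directions along an induced path\<close>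

definition dir :: "pos \<Rightarrow> pos \<Rightarrow> nat" where
  "dir p q = (LEAST i. i < 4 \<and> q = padd p (eps i))"

definition opp :: "nat \<Rightarrow> nat" where
  "opp i = (i + 2) mod 4"

lemma less_4_cases: "i < 4 \<Longrightarrow> i = 0 \<or> i = 1 \<or> i = 2 \<or> i = (3::nat)"
  by auto

lemma opp_less [simp]: "opp i < 4"
  by (simp add: opp_def)

lemma opp_opp: "i < 4 \<Longrightarrow> opp (opp i) = i"
  using less_4_cases[of i] by (auto simp: opp_def)

lemma padd_eps_inj: "i < 4 \<Longrightarrow> j < 4 \<Longrightarrow> padd p (eps i) = padd p (eps j) \<longleftrightarrow> i = j"
  using less_4_cases[of i] less_4_cases[of j] by (auto simp: padd_def eps_def)

lemma padd_eps_opp: "i < 4 \<Longrightarrow> padd (padd p (eps i)) (eps (opp i)) = p"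
  using less_4_cases[of i] by (auto simp: padd_def eps_def opp_def)

lemma dir_padd_eps: "i < 4 \<Longrightarrow> dir p (padd p (eps i)) = i"
  unfolding dir_def by (rule Least_equality) (auto simp: padd_eps_inj)

lemma adj_dir:
  assumes "adj p q"
  shows "dir p q < 4" and "padd p (eps (dir p q)) = q" and "dir q p = opp (dir p q)" and "adj q p"
proof -
  obtain i where i: "i < 4" "q = padd p (eps i)" using assms by (auto simp: adj_def)
  then have p: "p = padd q (eps (opp i))" by (simp add: padd_eps_opp)
  then show "adj q p" by (auto simp: adj_def intro: exI[of _ "opp i"])
  show "dir p q < 4" "padd p (eps (dir p q)) = q" "dir q p = opp (dir p q)"
    using i dir_padd_eps[of i p] dir_padd_eps[of "opp i" q] p by auto
qed

lemma adj_commute: "adj p q \<longleftrightarrow> adj q p"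
  using adj_dir(4) by blast

lemma not_adj_self: "\<not> adj p p"
  unfolding adj_def padd_def eps_def using less_4_cases by (force simp: prod_eq_iff)

lemma is_config_adj_iff:
  assumes "is_config L" and "x < length L" "y < length L"
  shows "adj (L ! x) (L ! y) \<longleftrightarrow> y = Suc x \<or> x = Suc y"
proof
  assume a: "adj (L ! x) (L ! y)"
  then have "x \<noteq> y" using not_adj_self by metis
  moreover have "\<not> x + 2 \<le> y" "\<not> y + 2 \<le> x"
    using a adj_dir(4)[OF a] assms by (auto simp: is_config_def)
  ultimately show "y = Suc x \<or> x = Suc y" by linarith
next
  assume "y = Suc x \<or> x = Suc y"
  then show "adj (L ! x) (L ! y)"
    using assms adj_commute[of "L ! x" "L ! y"] by (auto simp: is_config_def)
qed

lemma is_config_rev: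
  assumes "is_config L"
  shows "is_config (rev L)"
proof -
  have "adj (rev L ! n) (rev L ! Suc n)" if "Suc n < length L" for n
    using that is_config_adj_iff[OF assms, of "length L - Suc n" "length L - Suc (Suc n)"]
    by (auto simp: rev_nth)
  moreover have "\<not> adj (rev L ! l) (rev L ! m)" if "m < length L" "l + 2 \<le> m" for l m
    using that is_config_adj_iff[OF assms, of "length L - Suc l" "length L - Suc m"]
    by (auto simp: rev_nth)
  ultimately show ?thesis using assms by (simp add: is_config_def)
qed

definition left_dir :: "pos list \<Rightarrow> nat \<Rightarrow> nat" where
  "left_dir L x = dir (L ! x) (L ! (x - 1))"

definition right_dir :: "pos list \<Rightarrow> nat \<Rightarrow> nat" where
  "right_dir L x = dir (L ! x) (L ! Suc x)"

lemma config_dirs: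
  assumes "is_config L" and "Suc x < length L"
  shows "right_dir L x < 4" and "left_dir L (Suc x) = opp (right_dir L x)"
    and "padd (L ! x) (eps (right_dir L x)) = L ! Suc x"
    and "left_dir L (Suc x) < 4"
    and "padd (L ! Suc x) (eps (left_dir L (Suc x))) = L ! x"
    and "right_dir L x = opp (left_dir L (Suc x))"
proof -
  have a: "adj (L ! x) (L ! Suc x)" using assms by (simp add: is_config_def)
  note b = adj_dir(4)[OF a]
  show "right_dir L x < 4" "padd (L ! x) (eps (right_dir L x)) = L ! Suc x"
    using adj_dir(1,2)[OF a] by (simp_all add: right_dir_def)
  show "left_dir L (Suc x) < 4" "padd (L ! Suc x) (eps (left_dir L (Suc x))) = L ! x"
    using adj_dir(1,2)[OF b] by (simp_all add: left_dir_def)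
  show "left_dir L (Suc x) = opp (right_dir L x)"
    using adj_dir(3)[OF a] by (simp add: left_dir_def right_dir_def)
  show "right_dir L x = opp (left_dir L (Suc x))"
    using adj_dir(3)[OF b] by (simp add: left_dir_def right_dir_def)
qed

text \<open>Otherwise the path would step back onto its previous position.\<close>

lemma left_dir_neq_right_dir:
  assumes "is_config L" and "Suc (Suc x) < length L"
  shows "left_dir L (Suc x) \<noteq> right_dir L (Suc x)"
proof
  assume "left_dir L (Suc x) = right_dir L (Suc x)"
  then have "L ! x = L ! Suc (Suc x)"
    using config_dirs(5)[of L x] config_dirs(3)[of L "Suc x"] assms by simp
  then show False using assms by (auto simp: is_config_def nth_eq_iff_index_eq)
qed

text \<open>The path is induced, so a node has no neighbours in the configuration except its
  predecessor and its successor.\<close>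

lemma config_inputs_nth:
  assumes "is_config L" and "x < length L" and "i < 4"
  shows "inputs (set L) \<sigma> (L ! x) ! i =
    (if 0 < x \<and> i = left_dir L x then Some (\<sigma> (L ! (x - 1)))
     else if Suc x < length L \<and> i = right_dir L x then Some (\<sigma> (L ! Suc x)) else None)"
proof -
  let ?q = "padd (L ! x) (eps i)"
  have r: "inputs (set L) \<sigma> (L ! x) ! i = (if ?q \<in> set L then Some (\<sigma> ?q) else None)"
    using assms by (simp add: inputs_def)
  show ?thesis
  proof (cases "?q \<in> set L")
    case True
    then obtain y where y: "y < length L" "?q = L ! y" by (metis in_set_conv_nth)
    then have i: "i = dir (L ! x) (L ! y)" using assms(3) by (metis dir_padd_eps)
    have "adj (L ! x) (L ! y)" using y assms(3) unfolding adj_def by metis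
    then consider "y = Suc x" | "x = Suc y" using is_config_adj_iff[OF assms(1,2) y(1)] by blast
    then show ?thesis
    proof cases
      case 1
      then have "i = right_dir L x" using i by (simp add: right_dir_def)
      moreover have "\<not> (0 < x \<and> i = left_dir L x)"
        using left_dir_neq_right_dir[of L "x - 1"] assms(1) y(1) 1 \<open>i = right_dir L x\<close>
        by (cases x) auto
      ultimately show ?thesis using r y 1 True by auto
    next
      case 2
      then show ?thesis using r y True i by (simp add: left_dir_def)
    qed
  next
    case False
    then have "\<not> (0 < x \<and> i = left_dir L x)"
      using config_dirs(5)[of L "x - 1"] assms by (cases x) auto
    moreover have "\<not> (Suc x < length L \<and> i = right_dir L x)"
      using config_dirs(3)[of L x] assms False by auto
    ultimately show ?thesis using r False by simp
  qed
qed

text \<open>A path inside the configuration can only be traversed monotonically.\<close>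
lemma config_contains_segment:
  assumes "is_config L" and "M \<noteq> []" and "distinct M" and "set M \<subseteq> set L"
    and "\<And>n. Suc n < length M \<Longrightarrow> adj (M ! n) (M ! Suc n)"
  shows "\<exists>x y. x @ M @ y \<in> {L, rev L}"
  using assms(2-)
proof (induction M rule: list_nonempty_induct)
  case (single p)
  then obtain x y where "L = x @ [p] @ y" using split_list[of p L] by auto
  then show ?case by auto
next
  case (cons p M)
  have "adj (M ! n) (M ! Suc n)" if "Suc n < length M" for n
    using cons.prems(3)[of "Suc n"] that by simp
  moreover have "distinct M" "set M \<subseteq> set L" using cons.prems by auto
  ultimately obtain x y where xy: "x @ M @ y \<in> {L, rev L}"
    using cons.IH by meson
  define L' where "L' = x @ M @ y"
  have L': "L' = x @ M @ y" "L' \<in> {L, rev L}" by (rule L'_def) (unfold L'_def, rule xy)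
  have config: "is_config L'" using L'(2) assms(1) is_config_rev[of L] by (metis insertE singletonD)
  have "set L' = set L" using L'(2) by (metis insertE set_rev singletonD)
  then have "p \<in> set L'" using cons.prems(2) by simp
  then obtain n where n: "n < length L'" "L' ! n = p" by (metis in_set_conv_nth)
  have M0: "L' ! length x = M ! 0" using L'(1) cons.hyps by (simp add: nth_append)
  \<comment> \<open>\<open>p\<close> sits directly before or directly after the head of the embedded
    tail. In the second case the tail is a singleton, as its second element would occupy the place
    of \<open>p\<close>; reversing the configuration then puts \<open>p\<close> in front.\<close>
  have "adj p (M ! 0)" using cons.prems(3)[of 0] cons.hyps by simp
  then have "length x = Suc n \<or> n = Suc (length x)"
    using is_config_adj_iff[OF config n(1), of "length x"] n(2) M0 L'(1) cons.hyps by simp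
  then show ?case
  proof
    assume len: "length x = Suc n"
    then have "x \<noteq> []" by auto
    moreover from this have "p = last x" using n L'(1) len by (simp add: nth_append last_conv_nth)
    ultimately have "L' = butlast x @ (p # M) @ y"
      using L'(1) append_butlast_last_id[of x] by (metis append.assoc append_Cons append_Nil)
    then show ?case using L'(2) by metis
  next
    assume len: "n = Suc (length x)"
    have "p \<notin> set M" using cons.prems(1) by simp
    have "length M = 1"
    proof (rule ccontr)
      assume "length M \<noteq> 1"
      then have "1 < length M" using cons.hyps by (cases M) auto
      then have "L' ! n = M ! 1" using len L'(1) by (simp add: nth_append)
      then show False using n \<open>p \<notin> set M\<close> \<open>1 < length M\<close> by auto
    qed
    then obtain q where q: "M = [q]" by (cases M) auto
    then obtain y' where "y = p # y'" using n len L'(1) by (cases y) (auto simp: nth_append)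
    then have "rev L' = rev y' @ (p # M) @ rev x" using L'(1) q by simp
    moreover have "rev L' \<in> {L, rev L}" using L'(2) by (metis insertCI insertE rev_rev_ident singletonD)
    ultimately show ?case by metis
  qed
qed

section \<open>The automaton\<close>

text \<open>\<open>View t X K\<close>: flooding phase at time \<open>t\<close>, where \<open>X\<close> is empty or contains the own position and \<open>K\<close>
  are the known facts. \<open>Go\<close>, \<open>Sig\<close>: a signal that walks to one end, \<open>Sig\<close> naming the direction of
  the next node. \<open>Wave\<close>, \<open>On\<close>: oriented nodes with the directions of the left and right neighbour.\<close>
datatype state =
    Q
  | View nat "pos set" "(pos \<times> bool list) set"
  | Go
  | Sig nat
  | Wave "nat option" "nat option"
  | On "nat option" "nat option" cell

abbreviation blank :: cell where
  "blank \<equiv> N False False None None"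

text \<open>The index 4 is no direction, so \<open>other 4\<close> selects an arbitrary neighbour.\<close>
definition other :: "nat \<Rightarrow> state option list \<Rightarrow> nat option" where
  "other i ns = (if \<exists>e<4. e \<noteq> i \<and> ns ! e \<noteq> None
     then Some (LEAST e. e < 4 \<and> e \<noteq> i \<and> ns ! e \<noteq> None) else None)"

text \<open>Nodes not yet on the line count as blank, so oriented nodes stay unchanged while the
  wave is still travelling.\<close>

definition sees :: "cell \<Rightarrow> state option list \<Rightarrow> nat option \<Rightarrow> cell" where
  "sees c ns d = (case d of None \<Rightarrow> mirror c
     | Some i \<Rightarrow> (case ns ! i of Some (On l r c') \<Rightarrow> c' | _ \<Rightarrow> blank))"

text \<open>Every neighbour sees a signal or a wave, but it names the direction of its addressee,
  and only that node reacts.\<close>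

definition sig_from :: "state option list \<Rightarrow> nat \<Rightarrow> bool" where
  "sig_from ns i \<longleftrightarrow> i < 4 \<and> ns ! i = Some (Sig (opp i))"

definition wave_from :: "state option list \<Rightarrow> nat \<Rightarrow> bool" where
  "wave_from ns i \<longleftrightarrow> i < 4 \<and> (\<exists>r. ns ! i = Some (Wave (Some (opp i)) r))"

text \<open>The end reached by the signal becomes the right end and launches the wave; the node
  where the wave finally arrives becomes the left end and the only general of the line.\<close>

definition wake :: "state option list \<Rightarrow> state" where
  "wake ns =
    (if Ex (sig_from ns) then
       let i = Least (sig_from ns)
       in case other i ns of None \<Rightarrow> Wave (Some i) None | Some e \<Rightarrow> Sig e
     else if Ex (wave_from ns) then
       let i = Least (wave_from ns)
       in case other i ns of None \<Rightarrow> On None (Some i) G0 | Some e \<Rightarrow> Wave (Some e) (Some i)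
     else Q)"

fun view_places :: "state \<Rightarrow> pos set" where
  "view_places (View t X K) = X" | "view_places _ = {}"

fun view_facts :: "state \<Rightarrow> (pos \<times> bool list) set" where
  "view_facts (View t X K) = K" | "view_facts _ = {}"

text \<open>A node derives its own position from a neighbour that knows its own. Restricting to
  positions occurring in \<open>D\<close> keeps the state set finite.\<close>

definition new_places :: "(pos \<times> bool list) set \<Rightarrow> state \<Rightarrow> state option list \<Rightarrow> pos set" where
  "new_places D s ns = (view_places s \<union>
     {p. \<exists>i<4. \<exists>w. ns ! i = Some w \<and> padd p (eps i) \<in> view_places w}) \<inter> fst ` D"

text \<open>The boundary condition is read off from which inputs are present. The places are the
  updated ones, so that learning a position and recording its fact cost a single step.\<close>

definition new_facts ::
  "(pos \<times> bool list) set \<Rightarrow> state \<Rightarrow> state option list \<Rightarrow> (pos \<times> bool list) set" where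
  "new_facts D s ns = (view_facts s \<union> {f. \<exists>i<4. \<exists>w. ns ! i = Some w \<and> f \<in> view_facts w} \<union>
     {(p, map (\<lambda>w. w \<noteq> None) ns) | p. p \<in> new_places D s ns}) \<inter> D"

text \<open>A newly reached node takes over the clock of its neighbour. The bound
  \<open>t < T\<close> keeps quiescent nodes quiescent when the flooding ends.\<close>

definition heard :: "nat \<Rightarrow> state option list \<Rightarrow> nat \<Rightarrow> bool" where
  "heard T ns t \<longleftrightarrow> t < T \<and> (\<exists>i<4. \<exists>X K. ns ! i = Some (View t X K))"

text \<open>After an unsuccessful flooding only the general has \<open>(0,0)\<close> among its
  places, so it alone turns into \<open>Go\<close>.\<close>

fun squad_step :: "nat \<Rightarrow> (pos \<times> bool list) set \<Rightarrow> state \<Rightarrow> state option list \<Rightarrow> state" where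
  "squad_step T D Q ns = (if Ex (heard T ns)
     then View (Suc (Least (heard T ns))) (new_places D Q ns) (new_facts D Q ns) else wake ns)"
| "squad_step T D (View t X K) ns = (if t < T
     then View (Suc t) (new_places D (View t X K) ns) (new_facts D (View t X K) ns)
     else if (0,0) \<in> X then Go else Q)"
| "squad_step T D Go ns = (case other 4 ns of None \<Rightarrow> On None None G0 | Some e \<Rightarrow> Sig e)"
| "squad_step T D (Sig e) ns = Q"
| "squad_step T D (Wave l r) ns = On l r blank"
| "squad_step T D (On l r c) ns = On l r (cell_step (sees c ns l) c (sees c ns r))"

fun firing :: "nat \<Rightarrow> (pos \<times> bool list) set \<Rightarrow> state \<Rightarrow> bool" where
  "firing T D (View t X K) \<longleftrightarrow> t = T \<and> D \<subseteq> K"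
| "firing T D (On l r c) \<longleftrightarrow> c = Fired"
| "firing T D _ \<longleftrightarrow> False"

definition start :: "nat \<Rightarrow> (pos \<times> bool list) set \<Rightarrow> bool list \<Rightarrow> state" where
  "start T D b = View 0 ({(0,0)} \<inter> fst ` D) ({((0,0), b)} \<inter> D)"

definition dirs :: "nat option set" where
  "dirs = insert None (Some ` {..<4})"

definition states :: "nat \<Rightarrow> (pos \<times> bool list) set \<Rightarrow> state set" where
  "states T D = {Q, Go} \<union> (\<Union>t\<le>T. \<Union>X\<in>Pow (fst ` D). View t X ` Pow D) \<union> Sig ` {..<4} \<union>
     (\<Union>l\<in>dirs. Wave l ` dirs) \<union> (\<Union>l\<in>dirs. \<Union>r\<in>dirs. range (On l r))"

lemma finite_cells: "finite (UNIV :: cell set)"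
proof -
  let ?N = "(\<lambda>(r, l, a, b). N r l a b) ` UNIV"
  have "c \<in> {G0, G1, G2, Fired} \<union> ?N" for c
  proof (cases c)
    case (N r l a b)
    have "(\<lambda>(r, l, a, b). N r l a b) (r, l, a, b) \<in> ?N" by (rule imageI, rule UNIV_I)
    then show ?thesis unfolding N prod.case by (rule UnI2)
  qed simp_all
  moreover have "finite ?N" by (rule finite_imageI, rule finite_UNIV)
  ultimately show ?thesis by (intro finite_subset[of UNIV "{G0, G1, G2, Fired} \<union> ?N"]) auto
qed

lemma finite_states:
  assumes "finite D"
  shows "finite (states T D)"
proof -
  have "finite dirs" by (simp add: dirs_def)
  moreover have "finite (range (On l r))" for l r
    using finite_cells by (rule finite_imageI)
  ultimately show ?thesis unfolding states_def using assms by simp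
qed

lemma other_SomeD:
  assumes "other i ns = Some e"
  shows "e < 4 \<and> e \<noteq> i \<and> ns ! e \<noteq> None"
proof -
  let ?A = "\<lambda>e. e < 4 \<and> e \<noteq> i \<and> ns ! e \<noteq> None"
  have A: "\<exists>e. ?A e" and e: "e = Least ?A"
    using assms by (auto simp: other_def split: if_splits)
  show ?thesis unfolding e by (rule LeastI_ex[OF A])
qed

lemma other_dirs: "other i ns = Some e \<Longrightarrow> e < 4"
  using other_SomeD by blast

lemma sig_from_less: "sig_from ns i \<Longrightarrow> i < 4"
  and wave_from_less: "wave_from ns i \<Longrightarrow> i < 4"
  and heard_less: "heard T ns t \<Longrightarrow> t < T"
  by (simp_all add: sig_from_def wave_from_def heard_def)

lemma wake_in_states: "wake ns \<in> states T D"
proof -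
  have "Least (sig_from ns) < 4" if "Ex (sig_from ns)"
    using sig_from_less[OF LeastI_ex[OF that]] .
  moreover have "Least (wave_from ns) < 4" if "Ex (wave_from ns)"
    using wave_from_less[OF LeastI_ex[OF that]] .
  ultimately show ?thesis
    unfolding wake_def states_def dirs_def Let_def
    using other_dirs by (simp split: option.split) blast
qed

lemma in_states_iff:
  "Q \<in> states T D" "Go \<in> states T D" "Sig e \<in> states T D \<longleftrightarrow> e < 4"
  "View t X K \<in> states T D \<longleftrightarrow> t \<le> T \<and> X \<subseteq> fst ` D \<and> K \<subseteq> D"
  "Wave l r \<in> states T D \<longleftrightarrow> l \<in> dirs \<and> r \<in> dirs"
  "On l r c \<in> states T D \<longleftrightarrow> l \<in> dirs \<and> r \<in> dirs"
  by (auto simp: states_def image_iff)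

lemma new_places_subset: "new_places D s ns \<subseteq> fst ` D"
  by (simp add: new_places_def)

lemma new_facts_subset: "new_facts D s ns \<subseteq> D"
  by (simp add: new_facts_def)

lemma squad_step_in_states:
  assumes "s \<in> states T D"
  shows "squad_step T D s ns \<in> states T D"
proof (cases s)
  case Q
  have "Least (heard T ns) < T" if "Ex (heard T ns)"
    using heard_less[OF LeastI_ex[OF that]] .
  then show ?thesis using Q wake_in_states
    by (simp add: in_states_iff new_places_subset new_facts_subset Suc_le_eq)
next
  case (View t X K)
  then show ?thesis
    by (simp add: in_states_iff new_places_subset new_facts_subset Suc_le_eq)
next
  case Go
  then show ?thesis by (auto simp: in_states_iff dirs_def dest: other_dirs split: option.splits)
qed (use assms in \<open>auto simp: in_states_iff dirs_def\<close>)

lemma squad_step_quiescent: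
  assumes "length ns = 4" and "set ns \<subseteq> {None, Some Q}"
  shows "squad_step T D Q ns = Q"
proof -
  have "ns ! i \<in> set ns" if "i < 4" for i using that assms(1) by simp
  with assms(2) have "ns ! i = None \<or> ns ! i = Some Q" if "i < 4" for i using that by blast
  then have h: "\<not> heard T ns t" "\<not> sig_from ns i" "\<not> wave_from ns i" for t i
    unfolding heard_def sig_from_def wave_from_def by fastforce+
  have "\<not> Ex (heard T ns)" "\<not> Ex (sig_from ns)" "\<not> Ex (wave_from ns)"
    using h by blast+
  then show ?thesis by (simp only: squad_step.simps wake_def if_False)
qed

lemma squad_automaton:
  assumes "finite D"
  shows "\<exists>A. wf_fsa A \<and> (\<forall>L t. fires_at A L t \<longleftrightarrow>
    fires_in (squad_step T D) {s. firing T D s} (set L) (global_init (start T D) Q (set L)) t)"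
proof (rule encode_automaton[where S = "states T D"])
  show "start T D b \<in> states T D" for b
    by (simp add: start_def in_states_iff)
qed (use finite_states[OF assms] squad_step_in_states squad_step_quiescent in
    \<open>simp_all add: in_states_iff\<close>)

section \<open>Reading the neighbours along the path\<close>

definition dir_left :: "pos list \<Rightarrow> nat \<Rightarrow> nat option" where
  "dir_left L x = (if x = 0 then None else Some (left_dir L x))"

definition dir_right :: "pos list \<Rightarrow> nat \<Rightarrow> nat option" where
  "dir_right L x = (if Suc x < length L then Some (right_dir L x) else None)"

lemma config_inputs_not_None:
  assumes "is_config L" and "x < length L" and "i < 4"
  shows "inputs (set L) \<sigma> (L ! x) ! i \<noteq> None \<longleftrightarrow>
    dir_left L x = Some i \<or> dir_right L x = Some i"
  using config_inputs_nth[OF assms, of \<sigma>] by (auto simp: dir_left_def dir_right_def)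

lemma dir_left_right:
  assumes "is_config L" and "x < length L"
  shows "dir_left L x = Some i \<Longrightarrow> i < 4"
    and "dir_right L x = Some i \<Longrightarrow> i < 4"
    and "dir_left L x = Some i \<Longrightarrow> dir_right L x \<noteq> Some i"
    and "dir_left L x = Some i \<Longrightarrow> inputs (set L) \<sigma> (L ! x) ! i = Some (\<sigma> (L ! (x - 1)))"
    and "dir_right L x = Some i \<Longrightarrow> inputs (set L) \<sigma> (L ! x) ! i = Some (\<sigma> (L ! Suc x))"
proof -
  show 1: "dir_left L x = Some i \<Longrightarrow> i < 4" and 2: "dir_right L x = Some i \<Longrightarrow> i < 4"
    using config_dirs(4)[of L "x - 1"] config_dirs(1)[of L x] assms
    by (auto simp: dir_left_def dir_right_def split: if_splits)
  show 3: "dir_left L x = Some i \<Longrightarrow> dir_right L x \<noteq> Some i"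
    using left_dir_neq_right_dir[of L "x - 1"] assms
    by (auto simp: dir_left_def dir_right_def split: if_splits)
  show "dir_left L x = Some i \<Longrightarrow> inputs (set L) \<sigma> (L ! x) ! i = Some (\<sigma> (L ! (x - 1)))"
    using config_inputs_nth[OF assms 1, of \<sigma>] by (auto simp: dir_left_def split: if_splits)
  show "dir_right L x = Some i \<Longrightarrow> inputs (set L) \<sigma> (L ! x) ! i = Some (\<sigma> (L ! Suc x))"
    using config_inputs_nth[OF assms 2, of \<sigma>] 3 by (auto simp: dir_left_def dir_right_def split: if_splits)
qed

lemma config_inputs_SomeD:
  assumes "is_config L" and "x < length L" and "i < 4" and "inputs (set L) \<sigma> (L ! x) ! i = Some w"
  shows "dir_left L x = Some i \<and> 0 < x \<and> w = \<sigma> (L ! (x - 1)) \<or>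
    dir_right L x = Some i \<and> Suc x < length L \<and> w = \<sigma> (L ! Suc x)"
  using config_inputs_nth[OF assms(1-3), of \<sigma>] assms(4)
  by (auto simp: dir_left_def dir_right_def split: if_splits)

lemma other_eq_Some:
  assumes "d < 4" and "\<And>e. e < 4 \<Longrightarrow> e \<noteq> i \<and> ns ! e \<noteq> None \<longleftrightarrow> e = d"
  shows "other i ns = Some d"
proof -
  have "(LEAST e. e < 4 \<and> e \<noteq> i \<and> ns ! e \<noteq> None) = d"
    using assms by (intro Least_equality) auto
  moreover have "\<exists>e<4. e \<noteq> i \<and> ns ! e \<noteq> None" using assms by blast
  ultimately show ?thesis unfolding other_def by simp
qed

lemma other_eq_None:
  assumes "\<And>e. e < 4 \<Longrightarrow> e \<noteq> i \<Longrightarrow> ns ! e = None"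
  shows "other i ns = None"
  using assms unfolding other_def by metis

text \<open>The local choice made by \<open>other\<close> thus continues along the path, away from
  where a signal or wave came.\<close>

lemma other_left:
  assumes "is_config L" and "x < length L" and "dir_left L x = Some i"
  shows "other i (inputs (set L) \<sigma> (L ! x)) = dir_right L x"
proof (cases "dir_right L x")
  case None
  show ?thesis unfolding None
  proof (rule other_eq_None)
    fix e :: nat assume "e < 4" "e \<noteq> i"
    then show "inputs (set L) \<sigma> (L ! x) ! e = None"
      using config_inputs_not_None[OF assms(1,2), of e \<sigma>] assms(3) None by auto
  qed
next
  case (Some d)
  show ?thesis unfolding Some
    by (rule other_eq_Some) 
      (use config_inputs_not_None[OF assms(1,2), of _ \<sigma>] dir_left_right(1-3)[OF assms(1,2)] assms(3) Some in auto)
qed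

lemma other_right:
  assumes "is_config L" and "x < length L" and "dir_right L x = Some i"
  shows "other i (inputs (set L) \<sigma> (L ! x)) = dir_left L x"
proof (cases "dir_left L x")
  case None
  show ?thesis unfolding None
  proof (rule other_eq_None)
    fix e :: nat assume "e < 4" "e \<noteq> i"
    then show "inputs (set L) \<sigma> (L ! x) ! e = None"
      using config_inputs_not_None[OF assms(1,2), of e \<sigma>] assms(3) None by auto
  qed
next
  case (Some d)
  show ?thesis unfolding Some
    by (rule other_eq_Some) 
      (use config_inputs_not_None[OF assms(1,2), of _ \<sigma>] dir_left_right(1-3)[OF assms(1,2)] assms(3) Some in auto)
qed

section \<open>The general-purpose squad\<close>

definition on_line :: "pos list \<Rightarrow> (int \<Rightarrow> cell) \<Rightarrow> nat \<Rightarrow> state" where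
  "on_line L c x = On (dir_left L x) (dir_right L x) (c (int x))"

text \<open>With consistent orientations the nodes simulate a window of the unfolded line; at both
  ends \<open>mirror\<close> supplies the missing cell, as \<open>reflecting\<close>
  demands.\<close>

lemma global_step_on_line:
  assumes L: "is_config L" and \<sigma>: "\<And>x. x < length L \<Longrightarrow> \<sigma> (L ! x) = on_line L c x"
    and "reflecting (length L) c" and x: "x < length L"
  shows "global_step (squad_step T D) (set L) \<sigma> (L ! x) = on_line L (line_step c) x"
proof -
  let ?ns = "inputs (set L) \<sigma> (L ! x)"
  have "sees (c (int x)) ?ns (dir_left L x) = c (int x - 1)"
  proof (cases "x = 0")
    case True
    have "c (- 1 - 0) = mirror (c 0)" using assms(3) unfolding reflecting_def by blast
    then show ?thesis using True by (simp add: sees_def dir_left_def)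
  next
    case False
    then have "dir_left L x = Some (left_dir L x)" by (simp add: dir_left_def)
    then show ?thesis
      using dir_left_right(4)[OF L x, of "left_dir L x" \<sigma>] \<sigma>[of "x - 1"] x False
      by (simp add: sees_def on_line_def of_nat_diff)
  qed
  moreover have "sees (c (int x)) ?ns (dir_right L x) = c (int x + 1)"
  proof (cases "Suc x < length L")
    case True
    then have "dir_right L x = Some (right_dir L x)" by (simp add: dir_right_def)
    then show ?thesis
      using dir_left_right(5)[OF L x, of "right_dir L x" \<sigma>] \<sigma>[of "Suc x"] True
      by (simp add: sees_def on_line_def add.commute)
  next
    case False
    \<comment> \<open>For the last index \<open>x\<close>, the reflected index
      \<open>2 * length L - 1 - x\<close> is \<open>x + 1\<close>.\<close>
    then have "int (length L) = int x + 1" using x by linarith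
    moreover have "c (2 * int (length L) - 1 - int x) = mirror (c (int x))"
      using assms(3) unfolding reflecting_def by blast
    ultimately show ?thesis using False by (simp add: sees_def dir_right_def)
  qed
  ultimately show ?thesis
    using \<sigma>[OF x] by (simp add: global_step_def on_line_def line_step_def)
qed

lemma fires_on_line:
  assumes L: "is_config L"
    and \<sigma>: "\<And>x. x < length L \<Longrightarrow> \<sigma> (L ! x) = on_line L (start_line (length L)) x"
  shows "\<exists>t. fires_in (squad_step T D) {s. firing T D s} (set L) \<sigma> t"
proof -
  let ?n = "length L"
  have n: "1 \<le> ?n" using L by (cases L) (auto simp: is_config_def)
  have "reflecting ?n ((line_step ^^ u) (start_line ?n)) \<and>
      (\<forall>x<?n. (global_step (squad_step T D) (set L) ^^ u) \<sigma> (L ! x) =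
        on_line L ((line_step ^^ u) (start_line ?n)) x)" for u
  proof (induction u)
    case 0
    then show ?case using reflecting_start_line \<sigma> by simp
  next
    case (Suc u)
    then show ?case using reflecting_line_step global_step_on_line[OF L] by simp
  qed
  then have *: "(global_step (squad_step T D) (set L) ^^ u) \<sigma> (L ! x) =
      on_line L ((line_step ^^ u) (start_line ?n)) x" if "x < ?n" for u x
    using that by blast
  have "1 \<le> 2 * int ?n - 1" using n by simp
  then obtain t where "\<forall>x. (line_step ^^ t) (start_line ?n) x = Fired"
      "\<forall>u<t. \<forall>x. (line_step ^^ u) (start_line ?n) x \<noteq> Fired"
    using gaps_synchronize[OF gaps_start_line[OF n]] by blast
  then show ?thesis
    unfolding fires_in_def all_set_conv_all_nth by (intro exI[of _ t]) (simp add: * on_line_def)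
qed

section \<open>The orienting wave and the signal preceding it\<close>

lemma fires_in_stepI:
  assumes "\<And>p. p \<in> P \<Longrightarrow> \<sigma> p \<notin> F" and "\<And>p. p \<in> P \<Longrightarrow> global_step \<delta> P \<sigma> p = \<sigma>' p"
    and "\<exists>t. fires_in \<delta> F P \<sigma>' t"
  shows "\<exists>t. fires_in \<delta> F P \<sigma> t"
  using fires_in_add[of 1 P \<delta> \<sigma> F \<sigma>'] assms by auto

text \<open>For \<open>m = 0\<close> the wave has arrived and this is the initial line with a single general.\<close>
definition wave_line :: "pos list \<Rightarrow> nat \<Rightarrow> nat \<Rightarrow> state" where
  "wave_line L m x =
    (if x < m then Q
     else if x = m \<and> m \<noteq> 0 then Wave (dir_left L x) (dir_right L x)
     else On (dir_left L x) (dir_right L x) (if x = 0 then G0 else blank))"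

lemma squad_step_Q:
  assumes "\<forall>q\<in>P. \<forall>t X K. \<sigma> q = View t X K \<longrightarrow> T \<le> t"
  shows "squad_step T D Q (inputs P \<sigma> p) = wake (inputs P \<sigma> p)"
proof -
  have "\<not> heard T (inputs P \<sigma> p) t" for t
  proof
    assume "heard T (inputs P \<sigma> p) t"
    then obtain i X K where "t < T" "i < 4" "inputs P \<sigma> p ! i = Some (View t X K)"
      unfolding heard_def by blast
    then show False
      using assms by (auto simp: inputs_def split: if_splits)
  qed
  then have "\<not> Ex (heard T (inputs P \<sigma> p))" by blast
  then show ?thesis by (simp only: squad_step.simps if_False)
qed

declare squad_step.simps(1) [simp del]

lemma wake_Q:
  assumes "\<And>i. \<not> sig_from ns i" "\<And>i. \<not> wave_from ns i"
  shows "wake ns = Q"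
proof -
  have "\<not> Ex (sig_from ns)" "\<not> Ex (wave_from ns)" using assms by blast+
  then show ?thesis by (simp only: wake_def if_False)
qed

lemma wake_sig:
  assumes "\<And>j. sig_from ns j \<longleftrightarrow> j = i"
  shows "wake ns = (case other i ns of None \<Rightarrow> Wave (Some i) None | Some e \<Rightarrow> Sig e)"
proof -
  have "Least (sig_from ns) = i" by (rule Least_equality) (simp_all add: assms)
  moreover have "Ex (sig_from ns)" using assms by blast
  ultimately show ?thesis by (simp only: wake_def if_True Let_def)
qed

lemma wake_wave:
  assumes "\<And>j. \<not> sig_from ns j" "\<And>j. wave_from ns j \<longleftrightarrow> j = i"
  shows "wake ns = (case other i ns of None \<Rightarrow> On None (Some i) G0 | Some e \<Rightarrow> Wave (Some e) (Some i))"
proof -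
  have "Least (wave_from ns) = i" by (rule Least_equality) (simp_all add: assms)
  moreover have "Ex (wave_from ns)" "\<not> Ex (sig_from ns)" using assms by blast+
  ultimately show ?thesis by (simp only: wake_def if_True if_False Let_def)
qed

lemma dir_right_Suc:
  assumes "is_config L" and "Suc x < length L"
  shows "dir_right L x = Some (right_dir L x)" and "dir_left L (Suc x) = Some (opp (right_dir L x))"
    and "right_dir L x < 4"
  using assms config_dirs(1,2)[OF assms] by (simp_all add: dir_right_def dir_left_def)

text \<open>Only the node to the left of the wave is addressed. The nodes behind it stay blank,
  since a \<open>Wave\<close> node counts as blank and the mirror image of a blank is blank.\<close>

lemma global_step_wave:
  assumes L: "is_config L" and m: "Suc m < length L"
    and \<sigma>: "\<And>x. x < length L \<Longrightarrow> \<sigma> (L ! x) = wave_line L (Suc m) x"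
    and x: "x < length L"
  shows "global_step (squad_step T D) (set L) \<sigma> (L ! x) = wave_line L m x"
proof -
  let ?ns = "inputs (set L) \<sigma> (L ! x)"
  note D = config_inputs_SomeD[OF L x, of _ \<sigma>]
  note \<sigma>x = \<sigma>[OF x]
  have views: "\<forall>q\<in>set L. \<forall>t X K. \<sigma> q = View t X K \<longrightarrow> T \<le> t"
    unfolding all_set_conv_all_nth using \<sigma> by (simp add: wave_line_def)
  have sig: "\<not> sig_from ?ns i" for i
    using D[of i] \<sigma>[of "x - 1"] \<sigma>[of "Suc x"] x
    by (auto simp: sig_from_def wave_line_def split: if_splits)
  consider "x < m" | "x = m" | "x = Suc m" | "Suc m < x" by linarith
  then show ?thesis
  proof cases
    case 1
    have "\<not> wave_from ?ns i" for i
      using D[of i] \<sigma>[of "x - 1"] \<sigma>[of "Suc x"] x 1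
      by (auto simp: wave_from_def wave_line_def split: if_splits)
    then have "wake ?ns = Q" using wake_Q sig by blast
    then show ?thesis
      using \<sigma>x 1 by (simp add: global_step_def squad_step_Q[OF views] wave_line_def)
  next
    case 2
    note r = dir_right_Suc[OF L m]
    have "wave_from ?ns j \<longleftrightarrow> j = right_dir L m" for j
    proof
      assume j: "wave_from ?ns j"
      then show "j = right_dir L m"
        using D[of j] \<sigma>[of "x - 1"] r 2 x by (auto simp: wave_from_def wave_line_def split: if_splits)
    next
      assume "j = right_dir L m"
      then show "wave_from ?ns j"
        using dir_left_right(5)[OF L x, of j \<sigma>] \<sigma>[of "Suc x"] r 2 m
        by (simp add: wave_from_def wave_line_def)
    qed
    note w = wake_wave[OF sig this]
    have "other (right_dir L m) ?ns = dir_left L m"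
      using other_right[OF L x, of "right_dir L m" \<sigma>] r 2 by simp
    then have "wake ?ns = wave_line L m m"
      using w r by (cases m) (simp_all add: wave_line_def dir_left_def)
    then show ?thesis
      using \<sigma>x 2 by (simp add: global_step_def squad_step_Q[OF views] wave_line_def)
  next
    case 3
    then show ?thesis using \<sigma>x by (simp add: global_step_def wave_line_def)
  next
    case 4
    have "sees blank ?ns (dir_left L x) = blank"
      using dir_left_right(4)[OF L x, of _ \<sigma>] \<sigma>[of "x - 1"] x 4
      by (auto simp: sees_def wave_line_def split: option.splits)
    moreover have "sees blank ?ns (dir_right L x) = blank"
      using dir_left_right(5)[OF L x, of _ \<sigma>] \<sigma>[of "Suc x"] x 4
      by (auto simp: sees_def wave_line_def dir_right_def split: option.splits if_splits)
    ultimately show ?thesis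
      using \<sigma>x 4 by (simp add: global_step_def wave_line_def)
  qed
qed

lemma fires_wave:
  assumes L: "is_config L"
    and "m < length L" and "\<And>x. x < length L \<Longrightarrow> \<sigma> (L ! x) = wave_line L m x"
  shows "\<exists>t. fires_in (squad_step T D) {s. firing T D s} (set L) \<sigma> t"
  using assms(2-)
proof (induction m arbitrary: \<sigma>)
  case 0
  then show ?case using fires_on_line[OF L, of \<sigma>]
    by (simp add: wave_line_def on_line_def start_line_nth)
next
  case (Suc m)
  let ?\<sigma>' = "global_step (squad_step T D) (set L) \<sigma>"
  have "\<exists>t. fires_in (squad_step T D) {s. firing T D s} (set L) ?\<sigma>' t"
    using Suc.IH[of ?\<sigma>'] Suc.prems global_step_wave[OF L, of m \<sigma>] by simp
  moreover have "\<forall>p\<in>set L. \<sigma> p \<notin> {s. firing T D s}"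
    unfolding all_set_conv_all_nth using Suc.prems by (simp add: wave_line_def)
  ultimately show ?case by (intro fires_in_stepI[of "set L" \<sigma> _ _ ?\<sigma>']) blast+
qed

definition sig_line :: "pos list \<Rightarrow> nat \<Rightarrow> nat \<Rightarrow> state" where
  "sig_line L m x = (if x = m then Sig (right_dir L m) else Q)"

lemma global_step_sig:
  assumes L: "is_config L" and m: "Suc m < length L"
    and \<sigma>: "\<And>x. x < length L \<Longrightarrow> \<sigma> (L ! x) = sig_line L m x"
    and x: "x < length L"
  shows "global_step (squad_step T D) (set L) \<sigma> (L ! x) =
    (if Suc (Suc m) < length L then sig_line L (Suc m) x else wave_line L (Suc m) x)"
proof -
  let ?ns = "inputs (set L) \<sigma> (L ! x)"
  note D = config_inputs_SomeD[OF L x, of _ \<sigma>]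
  note \<sigma>x = \<sigma>[OF x]
  have views: "\<forall>q\<in>set L. \<forall>t X K. \<sigma> q = View t X K \<longrightarrow> T \<le> t"
    unfolding all_set_conv_all_nth using \<sigma> by (simp add: sig_line_def)
  have wave: "\<not> wave_from ?ns i" for i
    using D[of i] \<sigma>[of "x - 1"] \<sigma>[of "Suc x"] x
    by (auto simp: wave_from_def sig_line_def split: if_splits)
  note r = dir_right_Suc[OF L m]
  consider "x = m" | "x = Suc m" | "x \<noteq> m" "x \<noteq> Suc m" by blast
  then show ?thesis
  proof cases
    case 1
    then show ?thesis using \<sigma>x by (simp add: global_step_def sig_line_def wave_line_def)
  next
    case 2
    have left: "dir_left L x = Some (opp (right_dir L m))" using r 2 by simp
    have "sig_from ?ns j \<longleftrightarrow> j = opp (right_dir L m)" for j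
    proof
      assume "sig_from ?ns j"
      then show "j = opp (right_dir L m)"
        using D[of j] \<sigma>[of "Suc x"] left 2 by (auto simp: sig_from_def sig_line_def split: if_splits)
    next
      assume "j = opp (right_dir L m)"
      then show "sig_from ?ns j"
        using dir_left_right(4)[OF L x, of j \<sigma>] \<sigma>[of "x - 1"] left r 2 m
        by (simp add: sig_from_def sig_line_def opp_opp)
    qed
    note w = wake_sig[OF this]
    have "other (opp (right_dir L m)) ?ns = dir_right L x"
      using other_left[OF L x left] .
    then have "wake ?ns =
        (if Suc (Suc m) < length L then sig_line L (Suc m) x else wave_line L (Suc m) x)"
      using w r 2 m by (simp add: wave_line_def sig_line_def dir_right_def)
    then show ?thesis
      using \<sigma>x 2 by (simp add: global_step_def squad_step_Q[OF views] sig_line_def)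
  next
    case 3
    \<comment> \<open>The node to the left of the signal sees it as well, but would be addressed
      only if both neighbours of \<open>L ! m\<close> lay in the same direction.\<close>
    have "\<not> sig_from ?ns i" for i
    proof
      assume i: "sig_from ?ns i"
      then have "dir_right L x = Some i" "Suc x = m" "opp i = right_dir L m"
        using D[of i] \<sigma>[of "x - 1"] \<sigma>[of "Suc x"] x 3
        by (auto simp: sig_from_def sig_line_def split: if_splits)
      moreover from this have "dir_left L m = Some (opp i)"
        using dir_right_Suc[OF L, of x] x m by auto
      ultimately show False using r(1) dir_left_right(3)[OF L, of m "opp i"] m by simp
    qed
    then have "wake ?ns = Q" using wake_Q wave by blast
    moreover have "\<not> Suc (Suc m) < length L \<Longrightarrow> x < Suc m" using 3 x by linarith
    ultimately show ?thesis
      using \<sigma>x 3 by (simp add: global_step_def squad_step_Q[OF views] wave_line_def sig_line_def)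
  qed
qed

lemma fires_sig:
  assumes L: "is_config L"
    and "Suc m < length L" and "\<And>x. x < length L \<Longrightarrow> \<sigma> (L ! x) = sig_line L m x"
  shows "\<exists>t. fires_in (squad_step T D) {s. firing T D s} (set L) \<sigma> t"
  using assms(2-)
proof (induction "length L - m" arbitrary: m \<sigma> rule: less_induct)
  case less
  let ?\<sigma>' = "global_step (squad_step T D) (set L) \<sigma>"
  have "\<exists>t. fires_in (squad_step T D) {s. firing T D s} (set L) ?\<sigma>' t"
  proof (cases "Suc (Suc m) < length L")
    case True
    then show ?thesis
      using less.hyps[of "Suc m" ?\<sigma>'] less.prems global_step_sig[OF L, of m \<sigma>] by simp
  next
    case False
    then show ?thesis
      using fires_wave[OF L, of "Suc m" ?\<sigma>'] less.prems global_step_sig[OF L, of m \<sigma>] by simp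
  qed
  moreover have "\<forall>p\<in>set L. \<sigma> p \<notin> {s. firing T D s}"
    unfolding all_set_conv_all_nth using less.prems by (simp add: sig_line_def)
  ultimately show ?case by (intro fires_in_stepI[of "set L" \<sigma> _ _ ?\<sigma>']) blast+
qed

definition go :: "pos \<Rightarrow> state" where
  "go p = (if p = (0,0) then Go else Q)"

lemma global_step_go:
  assumes L: "is_config L" and k: "L ! k = (0,0)" "k < length L" and x: "x < length L"
  shows "global_step (squad_step T D) (set L) go (L ! x) =
    (if x = k then case other 4 (inputs (set L) go (L ! k)) of None \<Rightarrow> On None None G0 | Some e \<Rightarrow> Sig e
     else Q)"
proof (cases "x = k")
  case True
  then show ?thesis using k by (simp add: global_step_def go_def)
next
  case False
  let ?ns = "inputs (set L) go (L ! x)"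
  have "L ! x \<noteq> (0,0)" using False L k x nth_eq_iff_index_eq[of L x k] by (simp add: is_config_def)
  then have "go (L ! x) = Q" by (simp add: go_def)
  moreover have "?ns ! i \<in> {None, Some Go, Some Q}" if "i < 4" for i
    using that by (simp add: inputs_def go_def)
  then have "\<not> sig_from ?ns i" "\<not> wave_from ?ns i" for i
    unfolding sig_from_def wave_from_def by fastforce+
  then have "wake ?ns = Q" using wake_Q by blast
  moreover have "squad_step T D Q ?ns = wake ?ns"
    by (rule squad_step_Q) (simp add: go_def split: if_splits)
  ultimately show ?thesis using False by (simp add: global_step_def)
qed

lemma fires_go:
  assumes L: "is_config L"
  shows "\<exists>t. fires_in (squad_step T D) {s. firing T D s} (set L) go t"
proof -
  obtain k where k: "L ! k = (0,0)" "k < length L"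
    using L by (auto simp: is_config_def in_set_conv_nth)
  let ?ns = "inputs (set L) go (L ! k)" and ?\<sigma>' = "global_step (squad_step T D) (set L) go"
  note step = global_step_go[OF L k]
  have "\<exists>t. fires_in (squad_step T D) {s. firing T D s} (set L) ?\<sigma>' t"
  proof (cases "other 4 ?ns")
    case None
    have "dir_left L k = None \<and> dir_right L k = None"
    proof (rule ccontr)
      assume "\<not> ?thesis"
      then obtain i where i: "i < 4" "?ns ! i \<noteq> None"
        using config_inputs_not_None[OF L k(2)] dir_left_right(1,2)[OF L k(2)] by (metis not_None_eq)
      then have "\<exists>e<4. e \<noteq> 4 \<and> ?ns ! e \<noteq> None" by blast
      then show False using None unfolding other_def by simp
    qed
    then have "k = 0" "\<not> Suc k < length L" by (auto simp: dir_left_def dir_right_def split: if_splits)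
    moreover from this have "length L = 1" using k(2) by linarith
    ultimately show ?thesis
      using fires_wave[OF L, of 0 ?\<sigma>'] step None
      by (simp add: wave_line_def dir_left_def dir_right_def)
  next
    case (Some e)
    then have e: "e < 4" "?ns ! e \<noteq> None" using other_SomeD by blast+
    then consider "dir_left L k = Some e" | "dir_right L k = Some e"
      using config_inputs_not_None[OF L k(2) e(1), of go] by blast
    then show ?thesis
    proof cases
      case 1
      \<comment> \<open>If the chosen neighbour is on the left, the list is reversed. This changes
        neither the set of nodes nor the run, and the signal then moves to the right.\<close>
      let ?R = "rev L" and ?m = "length L - Suc k"
      have k0: "0 < k" "e = left_dir L k" using 1 by (auto simp: dir_left_def split: if_splits)
      have R: "?R ! ?m = (0,0)" "?m < length ?R" "Suc ?m < length ?R" "length L - Suc ?m = k"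
        using k k0 by (simp_all add: rev_nth)
      have "length L - Suc (Suc ?m) = k - Suc 0" using k k0 by linarith
      then have "right_dir ?R ?m = e"
        using k k0 by (simp add: right_dir_def left_dir_def rev_nth)
      moreover have "?\<sigma>' (?R ! x) = (if x = ?m then Sig e else Q)" if "x < length ?R" for x
        using step[of "length L - Suc x"] that Some k by (auto simp: rev_nth)
      ultimately show ?thesis
        using fires_sig[OF is_config_rev[OF L] R(3), of ?\<sigma>'] by (simp add: sig_line_def)
    next
      case 2
      then show ?thesis
        using fires_sig[OF L, of k ?\<sigma>'] step Some
        by (auto simp: sig_line_def dir_right_def split: if_splits)
    qed
  qed
  then show ?thesis by (intro fires_in_stepI[of "set L" go _ _ ?\<sigma>']) (simp_all add: go_def)
qed

section \<open>Flooding the boundary conditions\<close>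

definition true_facts :: "pos set \<Rightarrow> (pos \<times> bool list) set" where
  "true_facts P = (\<lambda>q. (q, bc P q)) ` P"

text \<open>Soundness invariant of the flooding. The general must keep its place, because it has to
  recognize itself when the flooding ends.\<close>

definition view_ok :: "pos set \<Rightarrow> nat \<Rightarrow> (pos \<Rightarrow> state) \<Rightarrow> bool" where
  "view_ok P t \<sigma> \<longleftrightarrow> (\<forall>p\<in>P. \<sigma> p = Q \<and> p \<noteq> (0,0) \<or>
     (\<exists>X K. \<sigma> p = View t X K \<and> X \<subseteq> {p} \<and> (p = (0,0) \<longrightarrow> p \<in> X) \<and> K \<subseteq> true_facts P))"

lemma view_okD:
  assumes "view_ok P t \<sigma>" and "p \<in> P"
  shows "\<sigma> p = Q \<and> p \<noteq> (0,0) \<or> (\<exists>X K. \<sigma> p = View t X K)"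
    and "view_places (\<sigma> p) \<subseteq> {p}" and "p = (0,0) \<Longrightarrow> p \<in> view_places (\<sigma> p)"
    and "view_facts (\<sigma> p) \<subseteq> true_facts P"
proof -
  have "\<sigma> p = Q \<and> p \<noteq> (0,0) \<or>
     (\<exists>X K. \<sigma> p = View t X K \<and> X \<subseteq> {p} \<and> (p = (0,0) \<longrightarrow> p \<in> X) \<and> K \<subseteq> true_facts P)"
    using assms unfolding view_ok_def by blast
  then show "\<sigma> p = Q \<and> p \<noteq> (0,0) \<or> (\<exists>X K. \<sigma> p = View t X K)"
    "view_places (\<sigma> p) \<subseteq> {p}" "p = (0,0) \<Longrightarrow> p \<in> view_places (\<sigma> p)"
    "view_facts (\<sigma> p) \<subseteq> true_facts P" by auto
qed

lemma inputs_nth: "i < 4 \<Longrightarrow> inputs P \<sigma> p ! i =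
    (if padd p (eps i) \<in> P then Some (\<sigma> (padd p (eps i))) else None)"
  by (simp add: inputs_def)

lemma inputs_SomeD:
  assumes "i < 4" and "inputs P \<sigma> p ! i = Some w"
  shows "padd p (eps i) \<in> P" and "w = \<sigma> (padd p (eps i))"
  using assms by (simp_all add: inputs_nth split: if_splits)

lemma view_ok_inputs:
  assumes "view_ok P t \<sigma>" and "i < 4" and "inputs P \<sigma> p ! i = Some w"
  shows "w = Q \<or> (\<exists>X K. w = View t X K)"
  unfolding inputs_SomeD(2)[OF assms(2,3)]
  using view_okD(1)[OF assms(1) inputs_SomeD(1)[OF assms(2,3)]] by blast

lemma map_inputs: "map (\<lambda>w. w \<noteq> None) (inputs P \<sigma> p) = bc P p"
  by (auto simp: inputs_def bc_def)

lemma padd_right_cancel: "padd p e = padd q e \<longleftrightarrow> p = q"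
  by (auto simp: padd_def prod_eq_iff)

text \<open>A node that stays quiescent is read as having no places and no facts, so both cases obey
  the same update.\<close>

lemma view_step:
  fixes D :: "(pos \<times> bool list) set"
  assumes ok: "view_ok P t \<sigma>" and "t < T" and p: "p \<in> P"
  defines "s' \<equiv> global_step (squad_step T D) P \<sigma> p"
  shows "s' = Q \<and> p \<noteq> (0,0) \<and> new_places D (\<sigma> p) (inputs P \<sigma> p) = {} \<and> new_facts D (\<sigma> p) (inputs P \<sigma> p) = {} \<or>
    s' = View (Suc t) (new_places D (\<sigma> p) (inputs P \<sigma> p)) (new_facts D (\<sigma> p) (inputs P \<sigma> p))"
proof -
  let ?ns = "inputs P \<sigma> p"
  have s': "s' = squad_step T D (\<sigma> p) ?ns" by (simp add: s'_def global_step_def)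
  consider X K where "\<sigma> p = View t X K" | "\<sigma> p = Q" "p \<noteq> (0,0)"
    using view_okD(1)[OF ok p] by blast
  then show ?thesis
  proof cases
    case 1
    then show ?thesis using s' \<open>t < T\<close> by simp
  next
    case 2
    show ?thesis
    proof (cases "heard T ?ns t")
      case True
      have "u = t" if u: "heard T ?ns u" for u
      proof -
        obtain i X K where "i < 4" "?ns ! i = Some (View u X K)"
          using u unfolding heard_def by blast
        then show ?thesis using view_ok_inputs[OF ok] by blast
      qed
      then have "Least (heard T ?ns) = t" using True by (metis LeastI)
      moreover have "Ex (heard T ?ns)" using True by blast
      ultimately show ?thesis using s' 2 by (simp add: squad_step.simps(1))
    next
      case False
      have ns: "?ns ! i \<in> {None, Some Q}" if "i < 4" for i
      proof (cases "?ns ! i")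
        case (Some w)
        then show ?thesis
          using view_ok_inputs[OF ok that Some] False that \<open>t < T\<close> unfolding heard_def by blast
      qed simp
      then have "set ?ns \<subseteq> {None, Some Q}"
        by (simp only: subset_code(1) all_set_conv_all_nth length_inputs) blast
      then have "s' = Q" using s' 2 squad_step_quiescent[of ?ns] by simp
      moreover have n: "\<not> (\<exists>w. ?ns ! i = Some w \<and> f \<in> view_facts w)"
        "\<not> (\<exists>w. ?ns ! i = Some w \<and> q \<in> view_places w)" if "i < 4" for i f q
        using ns[OF that] by auto
      have "new_places D Q ?ns = {}" using n(2) unfolding new_places_def view_places.simps by blast
      moreover from this have "new_facts D Q ?ns = {}" using n(1) unfolding new_facts_def view_facts.simps by blast
      ultimately show ?thesis using 2 by simp
    qed
  qed
qed

lemma view_step_simps: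
  assumes "view_ok P t \<sigma>" and "t < T" and "p \<in> P"
  shows "view_places (global_step (squad_step T D) P \<sigma> p) = new_places D (\<sigma> p) (inputs P \<sigma> p)"
    and "view_facts (global_step (squad_step T D) P \<sigma> p) = new_facts D (\<sigma> p) (inputs P \<sigma> p)"
  using view_step[OF assms, of D] by auto

lemma view_ok_step:
  assumes ok: "view_ok P t \<sigma>" and "t < T" and D: "(0,0) \<in> fst ` D"
  shows "view_ok P (Suc t) (global_step (squad_step T D) P \<sigma>)"
  unfolding view_ok_def
proof
  fix p assume p: "p \<in> P"
  let ?ns = "inputs P \<sigma> p"
  have "q = p" if "q \<in> new_places D (\<sigma> p) ?ns" for q
  proof -
    from that consider "q \<in> view_places (\<sigma> p)" |
      i w where "i < 4" "?ns ! i = Some w" "padd q (eps i) \<in> view_places w"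
      unfolding new_places_def by blast
    then show ?thesis
    proof cases
      case 1
      then show ?thesis using view_okD(2)[OF ok p] by blast
    next
      case 2
      note w = inputs_SomeD[OF 2(1,2)]
      \<comment> \<open>The neighbour knows no place but its own, so the derived position is the
        true one.\<close>
      then have "padd q (eps i) = padd p (eps i)" using 2(3) view_okD(2)[OF ok w(1)] by blast
      then show ?thesis by (simp add: padd_right_cancel)
    qed
  qed
  then have X: "new_places D (\<sigma> p) ?ns \<subseteq> {p}" by blast
  have "f \<in> true_facts P" if "f \<in> new_facts D (\<sigma> p) ?ns" for f
  proof -
    from that consider "f \<in> view_facts (\<sigma> p)" | i w where "i < 4" "?ns ! i = Some w" "f \<in> view_facts w"
      | q where "f = (q, map (\<lambda>w. w \<noteq> None) ?ns)" "q \<in> new_places D (\<sigma> p) ?ns"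
      unfolding new_facts_def by blast
    then show ?thesis
    proof cases
      case 1
      then show ?thesis using view_okD(4)[OF ok p] by blast
    next
      case 2
      note w = inputs_SomeD[OF 2(1,2)]
      then show ?thesis using 2(3) view_okD(4)[OF ok w(1)] by blast
    next
      case 3
      then have "q = p" using X by blast
      then have "f = (p, bc P p)" using 3(1) by (simp only: map_inputs)
      then show ?thesis using p by (simp add: true_facts_def)
    qed
  qed
  moreover have "p \<in> new_places D (\<sigma> p) ?ns" if "p = (0,0)"
    using view_okD(3)[OF ok p that] D that by (simp add: new_places_def)
  ultimately show "global_step (squad_step T D) P \<sigma> p = Q \<and> p \<noteq> (0,0) \<or>
     (\<exists>X K. global_step (squad_step T D) P \<sigma> p = View (Suc t) X K \<and> X \<subseteq> {p} \<and>
       (p = (0,0) \<longrightarrow> p \<in> X) \<and> K \<subseteq> true_facts P)"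
    using view_step[OF ok \<open>t < T\<close> p, of D] X by blast
qed

abbreviation view_run :: "nat \<Rightarrow> (pos \<times> bool list) set \<Rightarrow> pos set \<Rightarrow> nat \<Rightarrow> pos \<Rightarrow> state" where
  "view_run T D P t \<equiv> (global_step (squad_step T D) P ^^ t) (global_init (start T D) Q P)"

lemma view_ok_run:
  assumes "(0,0) \<in> fst ` D" and "t \<le> T"
  shows "view_ok P t (view_run T D P t)"
  using assms(2)
proof (induction t)
  case 0
  have "view_ok P 0 (global_init (start T D) Q P)"
    unfolding view_ok_def
  proof
    fix p assume "p \<in> P"
    then show "global_init (start T D) Q P p = Q \<and> p \<noteq> (0,0) \<or>
     (\<exists>X K. global_init (start T D) Q P p = View 0 X K \<and> X \<subseteq> {p} \<and>
       (p = (0,0) \<longrightarrow> p \<in> X) \<and> K \<subseteq> true_facts P)"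
      using assms(1) by (cases "p = (0,0)") (auto simp: global_init_def start_def true_facts_def)
  qed
  then show ?case by simp
next
  case (Suc t)
  then show ?case using view_ok_step[OF Suc.IH, of T D] assms(1) by simp
qed

lemma config_neighbour:
  assumes "is_config L" and "x < length L" "y < length L" and "y = Suc x \<or> x = Suc y"
  shows "\<exists>i<4. padd (L ! x) (eps i) = L ! y \<and> inputs (set L) \<sigma> (L ! x) ! i = Some (\<sigma> (L ! y))"
proof -
  have "adj (L ! x) (L ! y)" using is_config_adj_iff assms by blast
  then obtain i where "i < 4" "padd (L ! x) (eps i) = L ! y" by (auto simp: adj_def)
  then show ?thesis using assms(3) by (auto simp: inputs_nth)
qed

lemma step_towards:
  assumes "x \<noteq> (m :: nat)"
  obtains y where "y = Suc x \<or> x = Suc y" and "\<bar>int m - int y\<bar> = \<bar>int m - int x\<bar> - 1"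
    and "min x m \<le> y" "y \<le> max x m"
proof (cases "x < m")
  case True
  then show ?thesis by (intro that[of "Suc x"]) auto
next
  case False
  then show ?thesis using assms by (intro that[of "x - 1"]) auto
qed

text \<open>Positions spread from \<open>k\<close> to \<open>m\<close> in |m - k| steps, passing the
  filter because all indices in between lie in the range from \<open>lo\<close> to
  \<open>hi\<close>. The fact about \<open>m\<close> then needs |m - x| further steps to
  \<open>x\<close>; being in \<open>D\<close>, it is forwarded by every node, also outside that
  range.\<close>

lemma view_run_complete:
  assumes L: "is_config L" and k: "L ! k = (0,0)" "lo \<le> k" "k \<le> hi" and hi: "hi < length L"
    and D: "\<And>m. lo \<le> m \<Longrightarrow> m \<le> hi \<Longrightarrow> (L ! m, bc (set L) (L ! m)) \<in> D"
    and "t \<le> T"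
  shows "(\<forall>x. lo \<le> x \<longrightarrow> x \<le> hi \<longrightarrow> \<bar>int x - int k\<bar> \<le> int t \<longrightarrow>
      L ! x \<in> view_places (view_run T D (set L) t (L ! x))) \<and>
    (\<forall>x m. x < length L \<longrightarrow> lo \<le> m \<longrightarrow> m \<le> hi \<longrightarrow> \<bar>int m - int k\<bar> + \<bar>int m - int x\<bar> \<le> int t \<longrightarrow>
      (L ! m, bc (set L) (L ! m)) \<in> view_facts (view_run T D (set L) t (L ! x)))"
  using \<open>t \<le> T\<close>
proof (induction t)
  case 0
  have k0: "((0,0), bc (set L) (0,0)) \<in> D" using D[of k] k by simp
  then have "(0,0) \<in> fst ` D" by force
  then have "L ! k \<in> view_places (view_run T D (set L) 0 (L ! k)) \<and>
      (L ! k, bc (set L) (L ! k)) \<in> view_facts (view_run T D (set L) 0 (L ! k))"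
    using k0 k(1) by (simp add: global_init_def start_def)
  moreover have "x = k \<and> m = k" if "\<bar>int m - int k\<bar> + \<bar>int m - int x\<bar> \<le> int 0" for x m
    using that by linarith
  moreover have "x = k" if "\<bar>int x - int k\<bar> \<le> int 0" for x
    using that by linarith
  ultimately show ?case by blast
next
  case (Suc t)
  let ?\<sigma> = "view_run T D (set L) t"
  have "(L ! k, bc (set L) (L ! k)) \<in> D" using D k by blast
  then have "(0,0) \<in> fst ` D" unfolding k(1) by force
  then have ok: "view_ok (set L) t ?\<sigma>" using view_ok_run Suc.prems by simp
  have t: "t < T" using Suc.prems by simp
  have IH1: "L ! x \<in> view_places (?\<sigma> (L ! x))"
    if "lo \<le> x" "x \<le> hi" "\<bar>int x - int k\<bar> \<le> int t" for x using Suc that by simp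
  have IH2: "(L ! m, bc (set L) (L ! m)) \<in> view_facts (?\<sigma> (L ! x))"
    if "x < length L" "lo \<le> m" "m \<le> hi" "\<bar>int m - int k\<bar> + \<bar>int m - int x\<bar> \<le> int t" for x m
    using Suc that by simp
  have places: "L ! x \<in> new_places D (?\<sigma> (L ! x)) (inputs (set L) ?\<sigma> (L ! x))"
    if x: "lo \<le> x" "x \<le> hi" "\<bar>int x - int k\<bar> \<le> int (Suc t)" for x
  proof -
    have "L ! x \<in> fst ` D" using D[OF x(1,2)] by force
    moreover have "L ! x \<in> view_places (?\<sigma> (L ! x)) \<or> (\<exists>i<4. \<exists>w.
        inputs (set L) ?\<sigma> (L ! x) ! i = Some w \<and> padd (L ! x) (eps i) \<in> view_places w)"
    proof (cases "x = k")
      case True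
      then show ?thesis using IH1[OF x(1,2)] by simp
    next
      case False
      then obtain y where y: "y = Suc x \<or> x = Suc y" "\<bar>int k - int y\<bar> = \<bar>int k - int x\<bar> - 1"
        "min x k \<le> y" "y \<le> max x k" using step_towards by blast
      have "L ! y \<in> view_places (?\<sigma> (L ! y))" using IH1[of y] y k x by linarith
      moreover have "x < length L" "y < length L" using x y k hi by linarith+
      ultimately show ?thesis using config_neighbour[OF L, of x y ?\<sigma>] y(1) by metis
    qed
    ultimately show ?thesis unfolding new_places_def by blast
  qed
  have facts: "(L ! m, bc (set L) (L ! m)) \<in> new_facts D (?\<sigma> (L ! x)) (inputs (set L) ?\<sigma> (L ! x))"
    if x: "x < length L" "lo \<le> m" "m \<le> hi" "\<bar>int m - int k\<bar> + \<bar>int m - int x\<bar> \<le> int (Suc t)" for x m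
  proof (cases "x = m")
    case True
    then have "L ! m \<in> new_places D (?\<sigma> (L ! x)) (inputs (set L) ?\<sigma> (L ! x))"
      using places[of x] x by simp
    then show ?thesis unfolding new_facts_def map_inputs using D[OF x(2,3)] True by blast
  next
    case False
    then obtain y where y: "y = Suc x \<or> x = Suc y" "\<bar>int m - int y\<bar> = \<bar>int m - int x\<bar> - 1"
      "min x m \<le> y" "y \<le> max x m" using step_towards by blast
    have yL: "y < length L" using x y hi by linarith
    have "(L ! m, bc (set L) (L ! m)) \<in> view_facts (?\<sigma> (L ! y))"
      using IH2[OF yL x(2,3)] y x by linarith
    then have "\<exists>i<4. \<exists>w. inputs (set L) ?\<sigma> (L ! x) ! i = Some w \<and>
        (L ! m, bc (set L) (L ! m)) \<in> view_facts w"
      using config_neighbour[OF L x(1) yL y(1), of ?\<sigma>] by metis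
    then show ?thesis unfolding new_facts_def using D[OF x(2,3)] by blast
  qed
  show ?case
    using places facts view_step_simps[OF ok t, of _ D] hi by simp
qed

text \<open>The clock prevents firing before \<open>T\<close>, and \<open>D \<noteq> {}\<close>
  excludes that a node is still quiescent at time \<open>T\<close>.\<close>

lemma view_run_fires:
  assumes D0: "(0,0) \<in> fst ` D" and "\<And>p. p \<in> P \<Longrightarrow> D \<subseteq> view_facts (view_run T D P T p)"
    and "D \<noteq> {}"
  shows "fires_in (squad_step T D) {s. firing T D s} P (global_init (start T D) Q P) T"
  unfolding fires_in_def
proof (intro conjI allI impI ballI)
  fix u p assume "u < T" "p \<in> P"
  then show "view_run T D P u p \<notin> {s. firing T D s}"
    using view_okD(1)[OF view_ok_run[OF D0, of u T P], of p] by auto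
next
  fix p assume p: "p \<in> P"
  then show "view_run T D P T p \<in> {s. firing T D s}"
    using view_okD(1)[OF view_ok_run[OF D0, of T T P] p] assms(2)[OF p] \<open>D \<noteq> {}\<close> by auto
qed

text \<open>Known facts are true, so no node ever knows a false element of \<open>D\<close> and none
  fires up to time \<open>T\<close>; one step later only the general is active.\<close>

lemma view_run_resets:
  assumes L: "is_config L" and D0: "(0,0) \<in> fst ` D" and not: "\<not> D \<subseteq> true_facts (set L)"
  shows "\<exists>t. fires_in (squad_step T D) {s. firing T D s} (set L)
    (global_init (start T D) Q (set L)) t"
proof -
  let ?P = "set L"
  note ok = view_ok_run[OF D0, of _ T ?P]
  have "view_run T D ?P u p \<notin> {s. firing T D s}" if "u < Suc T" "p \<in> ?P" for u p
  proof -
    have "\<not> D \<subseteq> view_facts (view_run T D ?P u p)"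
      using view_okD(4)[OF ok[of u], of p] not that by auto
    then show ?thesis using view_okD(1)[OF ok[of u], of p] that by auto
  qed
  moreover have "view_run T D ?P (Suc T) p = go p" if p: "p \<in> ?P" for p
  proof -
    let ?\<sigma> = "view_run T D ?P T"
    let ?ns = "inputs ?P ?\<sigma> p"
    have s: "view_run T D ?P (Suc T) p = squad_step T D (?\<sigma> p) ?ns"
      by (rule funpow_global_step_Suc)
    note v = view_okD[OF ok[of T]]
    from v(1)[OF order_refl p] consider "?\<sigma> p = Q" "p \<noteq> (0,0)" | X K where "?\<sigma> p = View T X K" by blast
    then show ?thesis
    proof cases
      case 1
      have ns: "?ns ! i = Some w \<Longrightarrow> w = Q \<or> (\<exists>X K. w = View T X K)" if "i < 4" for i w
        using view_ok_inputs[OF ok[OF order_refl] that] .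
      have "wake ?ns = Q"
        by (rule wake_Q) (use ns in \<open>fastforce simp: sig_from_def wave_from_def\<close>)+
      moreover have "squad_step T D Q ?ns = wake ?ns"
        by (rule squad_step_Q) (use v(1) in fastforce)
      ultimately show ?thesis using s 1 by (simp add: go_def)
    next
      case 2
      then show ?thesis using s v(2,3)[OF order_refl p] by (auto simp: go_def)
    qed
  qed
  moreover obtain t where "fires_in (squad_step T D) {s. firing T D s} ?P go t"
    using fires_go[OF L] by blast
  ultimately show ?thesis
    using fires_in_add[of "Suc T" ?P "squad_step T D" "global_init (start T D) Q ?P"
        "{s. firing T D s}" go t] by blast
qed

section \<open>Firing at time T when the facts of a segment hold\<close>

lemma seg_nth:
  assumes "i \<le> 0" "0 \<le> j" "- int k \<le> i"
  shows "length (seg L k i j) = nat (j - i + 1)"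
    and "n < nat (j - i + 1) \<Longrightarrow> seg L k i j ! n = L ! (nat (i + int k) + n)"
  using assms by (auto simp: seg_def cpos_def nth_upto nat_add_distrib nat_eq_iff intro!: arg_cong[where f = "(!) L"])

text \<open>The facts in \<open>D\<close> make the segment a path inside \<open>L'\<close> with
  unchanged boundary conditions. The rest of \<open>L'\<close> is then a pair in \<open>W\<close>,
  and its lengths are bounded by \<open>ff\<close> and \<open>gg\<close>.\<close>

lemma seg_fires:
  fixes i j :: int
  assumes L: "is_config L" and k: "k < length L" "L ! k = (0,0)"
    and i: "- int k \<le> i" "i \<le> 0" and j: "0 \<le> j" "j \<le> int (length L) - 1 - int k"
    and T: "enat (nat (-2*i + j)) + gg L k i j \<le> enat T" "enat (nat (2*j - i)) + ff L k i j \<le> enat T"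
    and L': "is_config L'" and D: "D = (\<lambda>p. (p, bc (set L) p)) ` set (seg L k i j)"
    and true: "D \<subseteq> true_facts (set L')"
  shows "fires_in (squad_step T D) {s. firing T D s} (set L') (global_init (start T D) Q (set L')) T"
proof -
  let ?M = "seg L k i j"
  note len = seg_nth(1)[OF i(2) j(1) i(1), of L] and nth = seg_nth(2)[OF i(2) j(1) i(1), of _ L]
  define a where "a = nat (i + int k)"
  have range: "a + n < length L" if "n < length ?M" for n
    using that i j k unfolding len a_def by linarith
  have M: "?M ! n = L ! (a + n)" if "n < length ?M" for n
    using nth that by (simp add: len a_def)
  have "?M \<noteq> []" using len i j by auto
  moreover have "distinct ?M"
    using L range by (auto simp: distinct_conv_nth M is_config_def nth_eq_iff_index_eq)
  moreover have "set ?M \<subseteq> set L'"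
    using true unfolding D true_facts_def by auto
  moreover have "adj (?M ! n) (?M ! Suc n)" if "Suc n < length ?M" for n
    using that range[of "Suc n"] L by (simp add: M is_config_def)
  ultimately obtain x0 x1 where x: "x0 @ ?M @ x1 \<in> {L', rev L'}"
    using config_contains_segment[OF L'] by blast
  \<comment> \<open>\<open>R\<close> is \<open>L'\<close> or its reversal. A run depends only on the
    set of positions, so it may be analysed along \<open>R\<close>, where the segment has the same
    direction as in \<open>L\<close>.\<close>
  define R where "R = x0 @ ?M @ x1"
  have R: "is_config R" "set R = set L'"
    using x is_config_rev[OF L'] L' unfolding R_def[symmetric] by auto
  have bc: "bc (set R) p = bc (set L) p" if "p \<in> set ?M" for p
    using true that R(2) unfolding D true_facts_def by auto
  have "cpos L k l \<in> set ?M" if "l \<in> {i..j}" for l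
    using that by (simp add: seg_def)
  then have "(x0, x1) \<in> W L k i j"
    using R(1) bc by (simp add: W_def R_def[symmetric] del: set_append)
  then have "x0 \<in> U L k i j" "x1 \<in> V L k i j"
    unfolding U_def V_def by force+
  then have "enat (length x0) \<le> ff L k i j" "enat (length x1) \<le> gg L k i j"
    unfolding ff_def gg_def by (auto intro: SUP_upper)
  then have "enat (nat (-2*i + j) + length x1) \<le> enat T" "enat (nat (2*j - i) + length x0) \<le> enat T"
    using T add_left_mono order_trans unfolding plus_enat_simps(1)[symmetric] by blast+
  then have T': "- 2 * i + j + int (length x1) \<le> int T" "2 * j - i + int (length x0) \<le> int T"
    using i j by simp_all
  \<comment> \<open>The indices in \<open>R\<close> of p_i, p_j and the general.\<close>
  let ?lo = "length x0" and ?hi = "length x0 + nat (j - i)" and ?k = "length x0 + nat (- i)"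
  have Rnth: "R ! (?lo + n) = ?M ! n" if "n < length ?M" for n
    using that by (simp add: R_def nth_append)
  have "?M ! nat (- i) = L ! k" using M[of "nat (- i)"] i j by (simp add: len a_def nat_add_distrib[symmetric])
  then have k': "R ! ?k = (0,0)" using Rnth[of "nat (- i)"] k i j by (simp add: len)
  have lenR: "int (length R) = int (length x0) + (j - i + 1) + int (length x1)"
    using i j by (simp add: R_def len)
  have inD: "(R ! m, bc (set R) (R ! m)) \<in> D" if "?lo \<le> m" "m \<le> ?hi" for m
  proof -
    have "m - ?lo < length ?M" using that i j len by linarith
    then have "R ! m \<in> set ?M" using Rnth[of "m - ?lo"] that by simp
    then show ?thesis using bc D by auto
  qed
  have r: "?lo \<le> ?k" "?k \<le> ?hi" "?hi < length R" using i j lenR by linarith+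
  note complete = conjunct2[OF view_run_complete[where lo = ?lo and hi = ?hi and D = D and T = T,
        OF R(1) k' r, OF _ order_refl]]
  have facts: "(R ! m, bc (set R) (R ! m)) \<in> view_facts (view_run T D (set R) T (R ! x))"
    if x: "x < length R" and m: "?lo \<le> m" "m \<le> ?hi" for x m
  proof -
    \<comment> \<open>The extreme cases are the fact about p_i at the right end, at time -i + (j -
      i) + |x1|, and the fact about p_j at the left end, at time j + (j - i) + |x0|. These are
      exactly the two quantities bounded by \<open>T'\<close>.\<close>
    have "\<bar>int m - int ?k\<bar> + \<bar>int m - int x\<bar> \<le> int T"
      using x m i j lenR T' by (simp add: abs_if) linarith
    then show ?thesis using complete[OF inD] x m by blast
  qed
  have "D \<subseteq> view_facts (view_run T D (set L') T p)" if "p \<in> set L'" for p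
  proof
    fix d assume "d \<in> D"
    then obtain n where n: "n < length ?M" "d = (?M ! n, bc (set L) (?M ! n))"
      unfolding D by (auto simp: in_set_conv_nth)
    have "p \<in> set R" unfolding R(2) by (rule that)
    then obtain y where y: "y < length R" "R ! y = p" unfolding in_set_conv_nth by blast
    have "?lo + n \<le> ?hi" using n(1) len i j by linarith
    then show "d \<in> view_facts (view_run T D (set L') T p)"
      using facts[OF y(1) le_add1, of n]
      unfolding y(2) n(2) Rnth[OF n(1)] R(2) bc[OF nth_mem[OF n(1)], unfolded R(2)] by blast
  qed
  moreover have "(0,0) \<in> set ?M"
    using nth_mem[of "nat (- i)" ?M] \<open>?M ! nat (- i) = L ! k\<close> k i j by (simp add: len)
  then have "(0,0) \<in> fst ` D" unfolding D by (simp add: image_image)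
  ultimately show ?thesis using view_run_fires[of D "set L'" T] by auto
qed

theorem theorem4:
  fixes L :: "pos list" and k :: nat
  assumes "is_config L" and "k < length L" and "L ! k = (0,0)"
  shows "mft L \<le> Ttilde L k"
proof (cases "Ttilde L k")
  case infinity
  then show ?thesis by simp
next
  case (enat T)
  let ?I = "{- int k..0} \<times> {0..int (length L) - 1 - int k}"
  let ?f = "\<lambda>(i,j). max (enat (nat (-2*i + j)) + gg L k i j) (enat (nat (2*j - i)) + ff L k i j)"
  have "?I \<noteq> {}" using assms(2) by auto
  then have "Ttilde L k \<in> ?f ` ?I"
    unfolding Ttilde_def by (intro Min_in) auto
  then obtain i j where i: "- int k \<le> i" "i \<le> 0" and j: "0 \<le> j" "j \<le> int (length L) - 1 - int k"
    and T: "enat (nat (-2*i + j)) + gg L k i j \<le> enat T" "enat (nat (2*j - i)) + ff L k i j \<le> enat T"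
    unfolding enat by auto
  \<comment> \<open>The facts of the optimal segment, taken from \<open>L\<close>. A configuration
    satisfying all of them, such as \<open>L\<close>, fires at time \<open>T\<close>; any other one
    resets and fires later, so the automaton is a solution.\<close>
  define D where "D = (\<lambda>p. (p, bc (set L) p)) ` set (seg L k i j)"
  note fires = seg_fires[OF assms i j T _ D_def]
  have "set (seg L k i j) \<subseteq> set L"
    using i j by (auto simp: seg_def cpos_def intro!: nth_mem)
  then have "D \<subseteq> true_facts (set L)" unfolding D_def true_facts_def by blast
  note firesL = fires[OF assms(1) this]
  have "cpos L k 0 \<in> set (seg L k i j)" using i j by (simp add: seg_def)
  then have D0: "(0,0) \<in> fst ` D" using assms(3) by (simp add: D_def image_image cpos_def)
  have "finite D" by (simp add: D_def)
  then obtain A where A: "wf_fsa A" "\<And>L t. fires_at A L t \<longleftrightarrow>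
      fires_in (squad_step T D) {s. firing T D s} (set L) (global_init (start T D) Q (set L)) t"
    using squad_automaton[of D T] by blast
  have "\<exists>t. fires_at A L' t" if "is_config L'" for L'
    using fires[OF that] view_run_resets[OF that D0, of T] A(2) by blast
  then have "is_solution A" using A(1) by (simp add: is_solution_def)
  moreover have "fires_at A L T" using firesL A(2) by simp
  ultimately show ?thesis unfolding mft_def enat by (intro Inf_lower) auto
qed

end
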